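(* A connected graph $G$ is quasi-isometric to a tree if and only if there exist constants $\varepsilon>0$ and $k,m\in\mathbb{N}$ (with $k\ge4$ and $k\ge2m$) such that $G$ is $\varepsilon$-densely $(k,m)$-chordal.
   Context: Every edge of the connected graph $G$ has length $1$, interior points of edges are points of $G$, and $d$ is the induced shortest-path (length) metric on $G$. A map $f:(X,d_X)\to(Y,d_Y)$ between metric spaces is a quasi-isometry if there are constants $\lambda\ge1$, $C>0$, $D>0$ such that $\frac1\lambda d_X(x,x')-C\le d_Y(f(x),f(x'))\le\lambda d_X(x,x')+C$ for all $x,x'\in X$ and $d_Y(y,f(X))\le D$ for all $y\in Y$; then $X$ and $Y$ are quasi-isometric. Paths are finite and simple. A cycle is a simple closed curve, given by a sequence of vertices all different except that the first and last coincide. $L(\cdot)$ denotes length. For a cycle $C$, $d_C$ denotes the length metric on $C$. A shortcut in $C$ is a path $\sigma$ in $G$ joining two vertices $p,q$ of $C$ with $L(\sigma)<d_C(p,q)$; it is strict if $\sigma\cap C=\{p,q\}$, and then $p,q$ are the shortcut vertices associated to $\sigma$. A subset $A$ of a metric space $(X,\rho)$ is $\varepsilon$-dense if for every $x\in X$ there is $a\in A$ with $\rho(a,x)<\varepsilon$. $G$ is $\varepsilon$-densely $(k,m)$-chordal if for every cycle $C$ with $L(C)\ge k$ there exist strict shortcuts $\sigma_1,\dots,\sigma_r$ in $C$ with $L(\sigma_i)\le m$ for all $i$ whose associated shortcut vertices form an $\varepsilon$-dense subset of $(C,d_C)$. *)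

theory Defs
  imports Complex_Main
begin

text \<open>
  Graphs are simple and undirected, of arbitrary cardinality: a set of vertices together with a
  set of edges, each edge being an unordered pair of distinct vertices.
\<close>

type_synonym 'a sgraph = "'a set \<times> 'a set set"

definition verts :: "'a sgraph \<Rightarrow> 'a set" where
  "verts G = fst G"

definition edges :: "'a sgraph \<Rightarrow> 'a set set" where
  "edges G = snd G"

definition simple_graph :: "'a sgraph \<Rightarrow> bool" where
  "simple_graph G \<longleftrightarrow>
     (\<forall>e\<in>edges G. \<exists>u v. e = {u, v} \<and> u \<noteq> v \<and> u \<in> verts G \<and> v \<in> verts G)"

definition walk :: "'a sgraph \<Rightarrow> 'a list \<Rightarrow> bool" where
  "walk G p \<longleftrightarrow> p \<noteq> [] \<and> set p \<subseteq> verts G \<and> successively (\<lambda>u v. {u, v} \<in> edges G) p"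

definition simple_path :: "'a sgraph \<Rightarrow> 'a list \<Rightarrow> bool" where
  "simple_path G p \<longleftrightarrow> walk G p \<and> distinct p"

text \<open>
  The first vertex of a cycle is repeated at the end of the list, so \<open>4 \<le> length c\<close> says that
  there are at least three edges; it excludes constant sequences and \<open>[u, v, u]\<close>, which runs
  back along the same edge and is not a simple closed curve.
\<close>

definition cycle :: "'a sgraph \<Rightarrow> 'a list \<Rightarrow> bool" where
  "cycle G c \<longleftrightarrow> walk G c \<and> 4 \<le> length c \<and> hd c = last c \<and> distinct (tl c)"

text \<open>All edges have length 1, so the length of a path or cycle is its number of edges.\<close>

definition len :: "'a list \<Rightarrow> nat" where
  "len p = length p - 1"

text \<open>
  The subgraph traversed by a vertex sequence. For a cycle \<open>c\<close>, \<open>points (trace_graph c)\<close> is the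
  closed curve itself and \<open>gdist (trace_graph c)\<close> below is its own length metric.
\<close>

definition trace_graph :: "'a list \<Rightarrow> 'a sgraph" where
  "trace_graph p = (set p, {{p ! i, p ! Suc i} |i. Suc i < length p})"

definition connected_graph :: "'a sgraph \<Rightarrow> bool" where
  "connected_graph G \<longleftrightarrow> simple_graph G \<and> verts G \<noteq> {} \<and>
     (\<forall>u\<in>verts G. \<forall>v\<in>verts G. \<exists>p. simple_path G p \<and> hd p = u \<and> last p = v)"

definition tree :: "'a sgraph \<Rightarrow> bool" where
  "tree T \<longleftrightarrow> connected_graph T \<and> (\<nexists>c. cycle T c)"

text \<open>
  Points of the graph are given by their barycentric coordinates: \<open>edge_pt u v t\<close> is the point
  of the edge \<open>{u, v}\<close> at distance \<open>t\<close> from \<open>u\<close>. Thus \<open>edge_pt u v 0 = vpt u\<close>,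
  \<open>edge_pt u v 1 = vpt v\<close> and \<open>edge_pt u v t = edge_pt v u (1 - t)\<close>, and edges meet only in
  common end points.
\<close>

type_synonym 'a point = "'a \<Rightarrow> real"

definition vpt :: "'a \<Rightarrow> 'a point" where
  "vpt v = (\<lambda>w. if w = v then 1 else 0)"

definition edge_pt :: "'a \<Rightarrow> 'a \<Rightarrow> real \<Rightarrow> 'a point" where
  "edge_pt u v t = (\<lambda>w. (1 - t) * vpt u w + t * vpt v w)"

definition points :: "'a sgraph \<Rightarrow> 'a point set" where
  "points G = vpt ` verts G \<union> {edge_pt u v t |u v t. {u, v} \<in> edges G \<and> 0 \<le> t \<and> t \<le> 1}"

text \<open>
  \<open>pl_path G x y l\<close>: some piecewise linear path in \<open>G\<close> from \<open>x\<close> to \<open>y\<close>, i.e. a finite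
  concatenation of segments each lying in one closed edge, has length \<open>l\<close>.
\<close>

inductive pl_path :: "'a sgraph \<Rightarrow> 'a point \<Rightarrow> 'a point \<Rightarrow> real \<Rightarrow> bool"
  for G :: "'a sgraph" where
  nil: "x \<in> points G \<Longrightarrow> pl_path G x x 0"
| seg: "\<lbrakk>{u, v} \<in> edges G; 0 \<le> s; s \<le> 1; 0 \<le> t; t \<le> 1; pl_path G (edge_pt u v t) y l\<rbrakk>
    \<Longrightarrow> pl_path G (edge_pt u v s) y (\<bar>s - t\<bar> + l)"

text \<open>This length metric is meaningful for connected graphs, where the set is nonempty.\<close>

definition gdist :: "'a sgraph \<Rightarrow> 'a point \<Rightarrow> 'a point \<Rightarrow> real" where
  "gdist G x y = Inf {l. pl_path G x y l}"

definition quasi_isometry ::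
  "'x set \<Rightarrow> ('x \<Rightarrow> 'x \<Rightarrow> real) \<Rightarrow> 'y set \<Rightarrow> ('y \<Rightarrow> 'y \<Rightarrow> real) \<Rightarrow> ('x \<Rightarrow> 'y) \<Rightarrow> bool" where
  "quasi_isometry X dX Y dY f \<longleftrightarrow> f ` X \<subseteq> Y \<and>
     (\<exists>lam C D. lam \<ge> 1 \<and> C > 0 \<and> D > 0 \<and>
        (\<forall>x\<in>X. \<forall>x'\<in>X. 1 / lam * dX x x' - C \<le> dY (f x) (f x') \<and>
                        dY (f x) (f x') \<le> lam * dX x x' + C) \<and>
        (\<forall>y\<in>Y. (INF z\<in>f ` X. dY y z) \<le> D))"

definition quasi_isometric_graphs :: "'a sgraph \<Rightarrow> 'b sgraph \<Rightarrow> bool" where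
  "quasi_isometric_graphs G H \<longleftrightarrow>
     (\<exists>f. quasi_isometry (points G) (gdist G) (points H) (gdist H) f)"

definition shortcut :: "'a sgraph \<Rightarrow> 'a list \<Rightarrow> 'a list \<Rightarrow> bool" where
  "shortcut G c s \<longleftrightarrow> simple_path G s \<and> hd s \<in> set c \<and> last s \<in> set c \<and>
     real (len s) < gdist (trace_graph c) (vpt (hd s)) (vpt (last s))"

definition strict_shortcut :: "'a sgraph \<Rightarrow> 'a list \<Rightarrow> 'a list \<Rightarrow> bool" where
  "strict_shortcut G c s \<longleftrightarrow> shortcut G c s \<and>
     points (trace_graph s) \<inter> points (trace_graph c) = {vpt (hd s), vpt (last s)}"

definition eps_dense :: "real \<Rightarrow> 'x set \<Rightarrow> 'x set \<Rightarrow> ('x \<Rightarrow> 'x \<Rightarrow> real) \<Rightarrow> bool" where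
  "eps_dense \<epsilon> A X d \<longleftrightarrow> A \<subseteq> X \<and> (\<forall>x\<in>X. \<exists>a\<in>A. d a x < \<epsilon>)"

definition densely_chordal :: "'a sgraph \<Rightarrow> real \<Rightarrow> nat \<Rightarrow> nat \<Rightarrow> bool" where
  "densely_chordal G \<epsilon> k m \<longleftrightarrow>
     (\<forall>c. cycle G c \<and> len c \<ge> k \<longrightarrow>
        (\<exists>S. finite S \<and> (\<forall>s\<in>S. strict_shortcut G c s \<and> len s \<le> m) \<and>
             eps_dense \<epsilon> (\<Union>s\<in>S. {vpt (hd s), vpt (last s)})
               (points (trace_graph c)) (gdist (trace_graph c))))"

end

theory Submission
  imports Defs
begin

text \<open>
  Both directions go through the same picture: a graph is coarsely a tree exactly when a detour
  between two points cannot avoid the neighbourhood of the geodesic.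

  From chordality to a tree. Root the graph and put two vertices of the same level \<open>n\<close> into
  one layer when a walk joins them that never goes below level \<open>n\<close>. The layers form a tree,
  because the neighbours one level below a layer are joined by going up into it and back, and so
  form part of a single layer. What remains is that layers have bounded diameter (\<open>joined_close\<close>). Two
  vertices \<open>u\<close>, \<open>v\<close> of a layer, with geodesics down to the point where they first meet and the
  walk above level \<open>n\<close>, bound a cycle. Take a point \<open>x\<close> on the geodesic of \<open>u\<close> a fixed amount
  below level \<open>n\<close>. Some short shortcut has an end near \<open>x\<close>; it is too short to climb back to level
  \<open>n\<close>, and it cannot have both ends on the geodesic of \<open>u\<close>, since a geodesic admits no
  shortcut. So it reaches the geodesic of \<open>v\<close>. The two geodesics are thus close a bounded amount
  below level \<open>n\<close>, and so are \<open>u\<close> and \<open>v\<close>. Sending a vertex to its layer is then a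
  quasi-isometry (\<open>quasi_isometric_layer_tree\<close>).

  From a tree to chordality. In a tree three vertices have a median that every walk between any
  two of them must visit (\<open>tree_median\<close>). Pulled back along a quasi-isometry this says that every
  walk between the ends of a geodesic passes within a bounded distance of each point of the
  geodesic (\<open>bottleneck\<close>). On a long cycle consider an arc of length \<open>2 * h\<close> around a vertex
  \<open>x\<close>, with \<open>h\<close> above that bound. If the arc is not a geodesic of the graph, its ends are joined
  by a path shorter than their distance in the cycle. If it is one, the rest of the cycle is a walk
  between its ends, and so comes within less than \<open>h\<close> of \<open>x\<close> in the graph although it stays at
  distance at least \<open>h\<close> in the cycle. In both cases a short path starts near \<open>x\<close> and beats the
  distance in the cycle, and some excursion of that path away from the cycle is a strict shortcut
  (\<open>ex_strict_shortcut\<close>).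

  The length metric enters only through its values on vertices, where it is the number of edges of
  a shortest walk (\<open>gdist_vpt\<close>), and through the fact that every point is within distance 1 of
  a vertex.
\<close>

section \<open>Walks\<close>

definition walk_betw :: "'a sgraph \<Rightarrow> 'a \<Rightarrow> 'a list \<Rightarrow> 'a \<Rightarrow> bool" where
  "walk_betw G u p v \<longleftrightarrow> walk G p \<and> hd p = u \<and> last p = v"

lemma walk_betw_nonempty: "walk_betw G u p v \<Longrightarrow> p \<noteq> []"
  by (simp add: walk_betw_def walk_def)

lemma walk_betw_ends:
  assumes "walk_betw G u p v"
  shows "u \<in> set p" "v \<in> set p" "u \<in> verts G" "v \<in> verts G"
  using assms hd_in_set[of p] last_in_set[of p] by (auto simp: walk_betw_def walk_def)

lemma walk_betw_singleton: "u \<in> verts G \<Longrightarrow> walk_betw G u [u] u"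
  by (simp add: walk_betw_def walk_def)

lemma walk_betw_Cons:
  assumes "walk_betw G w p v" "{u, w} \<in> edges G" "u \<in> verts G"
  shows "walk_betw G u (u # p) v"
  using assms by (cases p) (auto simp: walk_betw_def walk_def)

lemma walk_betw_append:
  assumes "walk_betw G u p v" "walk_betw G v q w"
  shows "walk_betw G u (p @ tl q) w"
proof -
  let ?E = "\<lambda>u v. {u, v} \<in> edges G"
  have p: "p \<noteq> []" "set p \<subseteq> verts G" "successively ?E p" "hd p = u" "last p = v"
    and q: "q \<noteq> []" "set q \<subseteq> verts G" "successively ?E q" "hd q = v" "last q = w"
    using assms by (simp_all add: walk_betw_def walk_def)
  obtain q' where q': "q = v # q'" using q(1,4) by (cases q) auto
  have "successively ?E (p @ q')"
    using p q(3) q' by (cases q') (simp_all add: successively_append_iff)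
  moreover have "last (p @ q') = w" using p q q' by (cases q') simp_all
  ultimately show ?thesis using p q q' by (simp add: walk_betw_def walk_def)
qed

lemma len_append_tl: "p \<noteq> [] \<Longrightarrow> q \<noteq> [] \<Longrightarrow> len (p @ tl q) = len p + len q"
  by (cases p; cases q) (auto simp: len_def)

lemma len_Cons: "p \<noteq> [] \<Longrightarrow> len (u # p) = Suc (len p)"
  by (cases p) (auto simp: len_def)

lemma walk_betw_rev: "walk_betw G u p v \<Longrightarrow> walk_betw G v (rev p) u"
  by (simp add: walk_betw_def walk_def hd_rev last_rev insert_commute)

lemma len_rev [simp]: "len (rev p) = len p"
  by (simp add: len_def)

lemma walk_edge_nth: "walk G p \<Longrightarrow> Suc i < length p \<Longrightarrow> {p ! i, p ! Suc i} \<in> edges G"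
  by (auto simp: walk_def successively_conv_nth)

lemma walk_betw_segment:
  assumes "walk G p" "i \<le> j" "j < length p"
  shows "walk_betw G (p ! i) (take (Suc (j - i)) (drop i p)) (p ! j)"
proof -
  let ?q = "take (Suc (j - i)) (drop i p)"
  have ne: "?q \<noteq> []" and l: "length ?q = Suc (j - i)" using assms by auto
  have "set ?q \<subseteq> verts G"
    using assms set_take_subset[of "Suc (j - i)" "drop i p"] set_drop_subset[of i p]
    unfolding walk_def by blast
  moreover have "successively (\<lambda>u v. {u, v} \<in> edges G) ?q"
    using assms walk_edge_nth[OF assms(1)] by (auto simp: successively_conv_nth)
  moreover have "hd ?q = p ! i" using ne assms by (simp add: hd_drop_conv_nth)
  moreover have "last ?q = p ! j" using ne l assms by (simp add: last_conv_nth)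
  ultimately show ?thesis using ne by (simp add: walk_betw_def walk_def)
qed

lemma walk_betw_induct [consumes 1, case_names single step]:
  assumes "walk_betw G u p v"
    and "\<And>u. u \<in> verts G \<Longrightarrow> P u [u] u"
    and "\<And>u w p v. \<lbrakk>{u, w} \<in> edges G; u \<in> verts G; walk_betw G w p v; P w p v\<rbrakk> \<Longrightarrow> P u (u # p) v"
  shows "P u p v"
  using assms(1)
proof (induction p arbitrary: u)
  case Nil
  then show ?case by (simp add: walk_betw_def walk_def)
next
  case (Cons a p)
  then have a: "a = u" by (simp add: walk_betw_def)
  show ?case
  proof (cases p)
    case Nil
    have "u \<in> verts G" "v = u" using Cons.prems a Nil by (auto simp: walk_betw_def walk_def)
    then show ?thesis using a Nil assms(2)[of u] by metis
  next
    case p: (Cons w p')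
    have "{u, w} \<in> edges G" "u \<in> verts G" "walk_betw G w p v"
      using Cons.prems a p by (simp_all add: walk_betw_def walk_def)
    then show ?thesis unfolding a by (intro assms(3) Cons.IH)
  qed
qed

lemma walk_betw_split:
  "walk_betw G u (xs @ z # ys) v \<longleftrightarrow> walk_betw G u (xs @ [z]) z \<and> walk_betw G z (z # ys) v"
proof -
  let ?E = "\<lambda>u v. {u, v} \<in> edges G"
  have "successively ?E (xs @ z # ys) \<longleftrightarrow> successively ?E (xs @ [z]) \<and> successively ?E (z # ys)"
    unfolding successively_append_iff by auto
  moreover have "hd (xs @ z # ys) = hd (xs @ [z])" by (cases xs) auto
  ultimately show ?thesis by (auto simp: walk_betw_def walk_def)
qed

text \<open>Cutting out the loop between two visits of the same vertex leaves a shorter walk.\<close>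

lemma walk_betw_simple_path:
  assumes "walk_betw G u p v"
  shows "\<exists>q. walk_betw G u q v \<and> distinct q \<and> set q \<subseteq> set p \<and> len q \<le> len p"
  using assms
proof (induction "length p" arbitrary: p rule: less_induct)
  case less
  show ?case
  proof (cases "distinct p")
    case True
    then show ?thesis using less.prems by blast
  next
    case False
    then obtain xs ys zs y where p: "p = xs @ [y] @ ys @ [y] @ zs"
      using not_distinct_decomp by blast
    let ?q = "xs @ y # zs"
    have "walk_betw G u (xs @ y # (ys @ y # zs)) v" "walk_betw G u ((xs @ y # ys) @ y # zs) v"
      using less.prems unfolding p by simp_all
    then have "walk_betw G u ?q v"
      using walk_betw_split[of G u xs y "ys @ y # zs" v] walk_betw_split[of G u "xs @ y # ys" y zs v]
        walk_betw_split[of G u xs y zs v] by blast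
    then obtain q where "walk_betw G u q v" "distinct q" "set q \<subseteq> set ?q" "len q \<le> len ?q"
      using less.hyps[of ?q] p by auto
    moreover have "set ?q \<subseteq> set p" "len ?q \<le> len p" unfolding p by (auto simp: len_def)
    ultimately show ?thesis by (meson order_trans)
  qed
qed

lemma simple_path_walk_betw:
  "simple_path G p \<longleftrightarrow> walk_betw G (hd p) p (last p) \<and> distinct p"
  by (auto simp: simple_path_def walk_betw_def)

section \<open>The combinatorial distance\<close>

definition vdist :: "'a sgraph \<Rightarrow> 'a \<Rightarrow> 'a \<Rightarrow> nat" where
  "vdist G u v = (LEAST n. \<exists>p. walk_betw G u p v \<and> len p = n)"

lemma vdist_le: "walk_betw G u p v \<Longrightarrow> vdist G u v \<le> len p"
  unfolding vdist_def by (rule Least_le) blast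

locale connected_sgraph =
  fixes G :: "'a sgraph"
  assumes connected: "connected_graph G"
begin

lemma edge_ends:
  assumes "{u, v} \<in> edges G"
  shows "u \<noteq> v" "u \<in> verts G" "v \<in> verts G"
proof -
  obtain a b where "{u, v} = {a, b}" "a \<noteq> b" "a \<in> verts G" "b \<in> verts G"
    using assms connected unfolding connected_graph_def simple_graph_def by metis
  then show "u \<noteq> v" "u \<in> verts G" "v \<in> verts G" by (auto simp: doubleton_eq_iff)
qed

lemma ex_geodesic:
  assumes "u \<in> verts G" "v \<in> verts G"
  obtains p where "walk_betw G u p v" "len p = vdist G u v"
proof -
  have "\<exists>n p. walk_betw G u p v \<and> len p = n"
    using connected assms unfolding connected_graph_def simple_path_def walk_betw_def by meson
  from LeastI_ex[OF this] show ?thesis using that unfolding vdist_def by blast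
qed

lemma vdist_self [simp]: "u \<in> verts G \<Longrightarrow> vdist G u u = 0"
  using vdist_le[OF walk_betw_singleton] by (fastforce simp: len_def)

lemma vdist_commute:
  assumes "u \<in> verts G" "v \<in> verts G"
  shows "vdist G u v = vdist G v u"
proof -
  have "vdist G a b \<le> vdist G b a" if "a \<in> verts G" "b \<in> verts G" for a b
    using ex_geodesic[OF that(2,1)] vdist_le walk_betw_rev len_rev by metis
  then show ?thesis using assms by (simp add: le_antisym)
qed

lemma vdist_triangle:
  assumes "u \<in> verts G" "v \<in> verts G" "w \<in> verts G"
  shows "vdist G u w \<le> vdist G u v + vdist G v w"
proof -
  obtain p where p: "walk_betw G u p v" "len p = vdist G u v" using ex_geodesic assms by metis
  obtain q where q: "walk_betw G v q w" "len q = vdist G v w" using ex_geodesic assms by metis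
  show ?thesis
    using vdist_le[OF walk_betw_append[OF p(1) q(1)]] len_append_tl p q walk_betw_nonempty
    by metis
qed

lemma vdist_edge:
  assumes "{u, v} \<in> edges G"
  shows "vdist G u v \<le> 1"
  using vdist_le[OF walk_betw_Cons[OF walk_betw_singleton assms]] edge_ends[OF assms]
  by (simp add: len_def)

lemma vdist_walk:
  assumes "walk G p" "i \<le> j" "j < length p"
  shows "vdist G (p ! i) (p ! j) \<le> j - i"
  using vdist_le[OF walk_betw_segment[OF assms]] assms by (simp add: len_def)

lemma ex_simple_geodesic:
  assumes "u \<in> verts G" "v \<in> verts G"
  obtains p where "walk_betw G u p v" "distinct p" "len p = vdist G u v"
proof -
  obtain p where "walk_betw G u p v" "len p = vdist G u v" using ex_geodesic assms by metis
  then obtain q where "walk_betw G u q v" "distinct q" "len q \<le> vdist G u v"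
    using walk_betw_simple_path by metis
  then show ?thesis using that vdist_le by (metis le_antisym)
qed

text \<open>Each piece is at most as long as its walk, and the triangle inequality leaves no slack.\<close>

lemma vdist_on_geodesic:
  assumes "walk_betw G u p v" "len p = vdist G u v" "i < length p"
  shows "vdist G u (p ! i) = i" "vdist G (p ! i) v = len p - i"
proof -
  have p: "walk G p" "hd p = p ! 0" "last p = p ! (length p - 1)" "p \<noteq> []" "p ! 0 = u"
      "p ! (length p - 1) = v" "p ! i \<in> verts G"
    using assms walk_betw_nonempty[OF assms(1)]
    by (auto simp: walk_betw_def hd_conv_nth last_conv_nth walk_def)
  have le1: "vdist G u (p ! i) \<le> i" using vdist_walk[of p 0 i] p assms by simp
  have "vdist G (p ! i) (p ! (length p - 1)) \<le> length p - 1 - i"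
    by (rule vdist_walk) (use p assms(3) in auto)
  then have le2: "vdist G (p ! i) v \<le> len p - i" unfolding p(6) len_def .
  have "len p \<le> vdist G u (p ! i) + vdist G (p ! i) v"
    using vdist_triangle[OF walk_betw_ends(3)[OF assms(1)] p(7) walk_betw_ends(4)[OF assms(1)]]
      assms(2) by simp
  moreover have "i \<le> len p" using assms(3) by (simp add: len_def)
  ultimately show "vdist G u (p ! i) = i" "vdist G (p ! i) v = len p - i"
    using le1 le2 by linarith+
qed

end

section \<open>The length metric\<close>

lemma edge_pt_0 [simp]: "edge_pt u v 0 = vpt u"
  and edge_pt_1 [simp]: "edge_pt u v 1 = vpt v"
  by (auto simp: edge_pt_def)

lemma edge_pt_points: "{u, v} \<in> edges G \<Longrightarrow> 0 \<le> t \<Longrightarrow> t \<le> 1 \<Longrightarrow> edge_pt u v t \<in> points G"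
  unfolding points_def by blast

lemma vpt_points: "v \<in> verts G \<Longrightarrow> vpt v \<in> points G"
  by (simp add: points_def)

lemma pl_path_nonneg: "pl_path G x y l \<Longrightarrow> 0 \<le> l"
  by (induction rule: pl_path.induct) auto

lemma pl_path_trans: "pl_path G x y l \<Longrightarrow> pl_path G y z l' \<Longrightarrow> pl_path G x z (l + l')"
proof (induction rule: pl_path.induct)
  case (seg u v s t y l)
  then show ?case using pl_path.seg[of u v G s t z "l + l'"] by (simp add: add.assoc)
qed simp

lemma pl_path_segment:
  assumes "{u, v} \<in> edges G" "0 \<le> s" "s \<le> 1" "0 \<le> t" "t \<le> 1"
  shows "pl_path G (edge_pt u v s) (edge_pt u v t) \<bar>s - t\<bar>"
  using pl_path.seg[OF assms pl_path.nil[OF edge_pt_points[OF assms(1,4,5)]]] by simp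

lemma pl_path_sym: "pl_path G x y l \<Longrightarrow> pl_path G y x l"
proof (induction rule: pl_path.induct)
  case (seg u v s t y l)
  then show ?case
    using pl_path_trans[OF seg.IH pl_path_segment[of u v G t s]] by (simp add: abs_minus_commute add.commute)
qed (rule pl_path.nil)

lemma gdist_le: "pl_path G x y l \<Longrightarrow> gdist G x y \<le> l"
  unfolding gdist_def by (rule cInf_lower) (auto intro!: bdd_belowI[of _ 0] pl_path_nonneg)

lemma gdist_commute: "gdist G x y = gdist G y x"
proof -
  have "{l. pl_path G x y l} = {l. pl_path G y x l}" using pl_path_sym by blast
  then show ?thesis by (simp add: gdist_def)
qed

lemma gdist_ge:
  assumes "pl_path G x y l" "\<And>l. pl_path G x y l \<Longrightarrow> b \<le> l"
  shows "b \<le> gdist G x y"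
  unfolding gdist_def using assms by (intro cInf_greatest) auto

text \<open>
  A real function on the vertices extends affinely over the edges. If it changes by at most 1
  along every edge, the extension is 1-Lipschitz, and this is how distances are bounded below.
\<close>

definition affine_ext :: "('a \<Rightarrow> real) \<Rightarrow> 'a point \<Rightarrow> real" where
  "affine_ext h x = (\<Sum>w | x w \<noteq> 0. x w * h w)"

lemma affine_ext_edge_pt:
  assumes "u \<noteq> v"
  shows "affine_ext h (edge_pt u v t) = (1 - t) * h u + t * h v"
proof -
  have "affine_ext h (edge_pt u v t) = (\<Sum>w\<in>{u, v}. edge_pt u v t w * h w)"
    unfolding affine_ext_def
    by (rule sum.mono_neutral_left) (auto simp: edge_pt_def vpt_def)
  also have "\<dots> = (1 - t) * h u + t * h v"
    using assms by (simp add: edge_pt_def vpt_def)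
  finally show ?thesis .
qed

lemma affine_ext_vpt [simp]: "affine_ext h (vpt v) = h v"
proof -
  have "{w. vpt v w \<noteq> 0} = {v}" by (auto simp: vpt_def)
  then show ?thesis by (simp add: affine_ext_def vpt_def)
qed

context connected_sgraph
begin

lemma affine_ext_lipschitz:
  assumes h: "\<And>u v. {u, v} \<in> edges G \<Longrightarrow> \<bar>h u - h v\<bar> \<le> 1"
    and "pl_path G x y l"
  shows "\<bar>affine_ext h x - affine_ext h y\<bar> \<le> l"
  using assms(2)
proof (induction rule: pl_path.induct)
  case (seg u v s t y l)
  have "affine_ext h (edge_pt u v s) - affine_ext h (edge_pt u v t) = (s - t) * (h v - h u)"
    using edge_ends(1)[OF seg(1)] by (simp add: affine_ext_edge_pt algebra_simps)
  then have "\<bar>affine_ext h (edge_pt u v s) - affine_ext h (edge_pt u v t)\<bar> \<le> \<bar>s - t\<bar>"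
    using mult_left_mono[OF h[OF seg(1)], of "\<bar>s - t\<bar>"] by (simp add: abs_mult abs_minus_commute)
  then show ?case using seg.IH by linarith
qed simp

lemma pl_path_walk:
  assumes "walk_betw G u p v"
  shows "pl_path G (vpt u) (vpt v) (real (len p))"
  using assms
proof (induction rule: walk_betw_induct)
  case (single u)
  then show ?case by (simp add: len_def pl_path.nil vpt_points)
next
  case (step u w p v)
  show ?case
    using pl_path.seg[of u w G 0 1 "vpt v" "real (len p)"] step walk_betw_nonempty[OF step(3)]
    by (simp add: len_Cons)
qed

lemma near_vertex:
  assumes "x \<in> points G"
  obtains v l where "v \<in> verts G" "pl_path G x (vpt v) l" "l \<le> 1"
proof -
  consider v where "v \<in> verts G" "x = vpt v"
    | u v t where "{u, v} \<in> edges G" "0 \<le> t" "t \<le> 1" "x = edge_pt u v t"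
    using assms unfolding points_def by blast
  then show ?thesis
  proof cases
    case 1
    then show ?thesis using that[of v 0] pl_path.nil[OF assms] by simp
  next
    case 2
    then show ?thesis
      using that[of u t] pl_path_segment[of u v G t 0] edge_ends[OF 2(1)] by simp
  qed
qed

lemma ex_pl_path:
  assumes "x \<in> points G" "y \<in> points G"
  obtains l where "pl_path G x y l"
proof -
  obtain u l where u: "u \<in> verts G" "pl_path G x (vpt u) l" by (rule near_vertex[OF assms(1)])
  obtain v l' where v: "v \<in> verts G" "pl_path G y (vpt v) l'" by (rule near_vertex[OF assms(2)])
  obtain p where p: "walk_betw G u p v" by (rule ex_geodesic[OF u(1) v(1)])
  show ?thesis
    by (rule that[OF pl_path_trans[OF u(2) pl_path_trans[OF pl_path_walk[OF p] pl_path_sym[OF v(2)]]]])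
qed

lemma gdist_nonneg: "x \<in> points G \<Longrightarrow> y \<in> points G \<Longrightarrow> 0 \<le> gdist G x y"
  by (rule ex_pl_path[of x y]) (blast intro: gdist_ge pl_path_nonneg)+

lemma gdist_triangle:
  assumes "x \<in> points G" "y \<in> points G" "z \<in> points G"
  shows "gdist G x z \<le> gdist G x y + gdist G y z"
proof -
  have "gdist G x z - gdist G y z \<le> l" if "pl_path G x y l" for l
  proof -
    obtain l\<^sub>0 where l\<^sub>0: "pl_path G y z l\<^sub>0" by (rule ex_pl_path[OF assms(2,3)])
    have "gdist G x z - l \<le> l'" if "pl_path G y z l'" for l'
      using gdist_le[OF pl_path_trans[OF \<open>pl_path G x y l\<close> that]] by simp
    from gdist_ge[OF l\<^sub>0 this] show ?thesis by simp
  qed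
  moreover obtain l\<^sub>0 where "pl_path G x y l\<^sub>0" by (rule ex_pl_path[OF assms(1,2)])
  ultimately have "gdist G x z - gdist G y z \<le> gdist G x y" by (blast intro: gdist_ge)
  then show ?thesis by simp
qed

lemma gdist_lipschitz:
  assumes "\<And>u v. {u, v} \<in> edges G \<Longrightarrow> \<bar>h u - h v\<bar> \<le> 1" "x \<in> points G" "y \<in> points G"
  shows "\<bar>affine_ext h x - affine_ext h y\<bar> \<le> gdist G x y"
proof -
  obtain l where "pl_path G x y l" by (rule ex_pl_path[OF assms(2,3)])
  then show ?thesis by (rule gdist_ge) (rule affine_ext_lipschitz[OF assms(1)])
qed

text \<open>
  The extension of the distance from \<open>u\<close> is a Lipschitz function that vanishes at \<open>u\<close>, so
  no piecewise linear path can beat the shortest walk, not even one that turns back inside edges.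
\<close>

lemma gdist_vpt:
  assumes "u \<in> verts G" "v \<in> verts G"
  shows "gdist G (vpt u) (vpt v) = real (vdist G u v)"
proof (rule antisym)
  show "gdist G (vpt u) (vpt v) \<le> real (vdist G u v)"
  proof -
    obtain p where "walk_betw G u p v" "len p = vdist G u v" by (rule ex_geodesic[OF assms])
    then show ?thesis using gdist_le[OF pl_path_walk] by metis
  qed
  have "\<bar>real (vdist G u a) - real (vdist G u b)\<bar> \<le> 1" if e: "{a, b} \<in> edges G" for a b
    using vdist_triangle[OF assms(1) edge_ends(2,3)[OF e]] vdist_edge[OF e]
      vdist_triangle[OF assms(1) edge_ends(3,2)[OF e]] vdist_commute[OF edge_ends(2,3)[OF e]]
    by linarith
  from gdist_lipschitz[of "\<lambda>a. real (vdist G u a)", OF this vpt_points[OF assms(1)] vpt_points[OF assms(2)]]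
  show "real (vdist G u v) \<le> gdist G (vpt u) (vpt v)" using assms by simp
qed

lemma gdist_near_vertex:
  assumes "x \<in> points G"
  obtains v where "v \<in> verts G" "gdist G x (vpt v) \<le> 1"
proof -
  obtain v l where "v \<in> verts G" "pl_path G x (vpt v) l" "l \<le> 1" by (rule near_vertex[OF assms])
  then show ?thesis using that[of v] gdist_le[of G x "vpt v" l] by linarith
qed

end


section \<open>Cycles and their own length metric\<close>

lemma verts_trace [simp]: "verts (trace_graph p) = set p"
  and edges_trace: "edges (trace_graph p) = {{p ! i, p ! Suc i} |i. Suc i < length p}"
  by (simp_all add: trace_graph_def verts_def edges_def)

lemma edges_trace_subset: "walk G p \<Longrightarrow> edges (trace_graph p) \<subseteq> edges G"
  using walk_edge_nth unfolding edges_trace by blast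

lemma walk_trace:
  assumes "walk G p"
  shows "walk (trace_graph p) p"
proof -
  have "successively (\<lambda>u v. {u, v} \<in> edges (trace_graph p)) p"
    unfolding successively_conv_nth edges_trace by blast
  then show ?thesis using assms by (simp add: walk_def)
qed

lemma walk_betw_mono:
  assumes "walk_betw H u p v" "verts H \<subseteq> verts G" "edges H \<subseteq> edges G"
  shows "walk_betw G u p v"
proof -
  have "successively (\<lambda>u v. {u, v} \<in> edges G) p"
    using assms by (auto simp: walk_betw_def walk_def intro: successively_mono)
  then show ?thesis using assms by (auto simp: walk_betw_def walk_def)
qed

lemma (in connected_sgraph) connected_trace:
  assumes "walk G p"
  shows "connected_sgraph (trace_graph p)"
proof
  have "simple_graph (trace_graph p)"
    unfolding simple_graph_def
  proof
    fix e assume "e \<in> edges (trace_graph p)"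
    then obtain i where i: "e = {p ! i, p ! Suc i}" "Suc i < length p" unfolding edges_trace by blast
    then have "p ! i \<noteq> p ! Suc i" using edge_ends(1) walk_edge_nth[OF assms] by blast
    then show "\<exists>u v. e = {u, v} \<and> u \<noteq> v \<and> u \<in> verts (trace_graph p) \<and> v \<in> verts (trace_graph p)"
      using i by (intro exI[of _ "p ! i"] exI[of _ "p ! Suc i"]) simp
  qed
  moreover have "\<exists>q. simple_path (trace_graph p) q \<and> hd q = u \<and> last q = v"
    if uv: "u \<in> set p" "v \<in> set p" for u v
  proof -
    obtain i j where ij: "i < length p" "j < length p" "u = p ! i" "v = p ! j"
      using uv by (metis in_set_conv_nth)
    have "\<exists>q. walk_betw (trace_graph p) u q v"
    proof (cases "i \<le> j")
      case True
      then show ?thesis using walk_betw_segment[OF walk_trace[OF assms] True ij(2)] ij by blast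
    next
      case False
      then have "j \<le> i" by simp
      from walk_betw_rev[OF walk_betw_segment[OF walk_trace[OF assms] this ij(1)]]
      show ?thesis using ij by blast
    qed
    then obtain q where "walk_betw (trace_graph p) u q v" "distinct q"
      using walk_betw_simple_path by metis
    then show ?thesis by (auto simp: walk_betw_def simple_path_def)
  qed
  moreover have "p \<noteq> []" using assms by (simp add: walk_def)
  ultimately show "connected_graph (trace_graph p)" by (simp add: connected_graph_def)
qed

lemma (in connected_sgraph) vdist_le_vdist_trace:
  assumes "walk G p" "u \<in> set p" "v \<in> set p"
  shows "vdist G u v \<le> vdist (trace_graph p) u v"
proof -
  interpret P: connected_sgraph "trace_graph p" using connected_trace[OF assms(1)] .
  obtain q where q: "walk_betw (trace_graph p) u q v" "len q = vdist (trace_graph p) u v"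
    using P.ex_geodesic[of u v] assms(2,3) by auto
  have "walk_betw G u q v"
    using assms(1) edges_trace_subset[OF assms(1)] by (intro walk_betw_mono[OF q(1)]) (auto simp: walk_def)
  then show ?thesis using vdist_le q(2) by metis
qed

lemma cycle_closed: "cycle G c \<Longrightarrow> c ! len c = c ! 0"
  using hd_conv_nth[of c] last_conv_nth[of c] by (auto simp: cycle_def walk_def len_def)

lemma cycle_nth_inj:
  assumes "cycle G c" "c ! i = c ! j" "0 < i" "i \<le> len c" "0 < j" "j \<le> len c"
  shows "i = j"
proof -
  have "tl c ! (i - 1) = tl c ! (j - 1)" "i - 1 < length (tl c)" "j - 1 < length (tl c)"
    using assms by (auto simp: nth_tl len_def cycle_def)
  then show ?thesis
    using assms nth_eq_iff_index_eq[of "tl c" "i - 1" "j - 1"] by (auto simp: cycle_def)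
qed

section \<open>The layering of a rooted graph\<close>

locale rooted_sgraph = connected_sgraph +
  fixes root
  assumes root: "root \<in> verts G"
begin

definition lev :: "'a \<Rightarrow> nat" where
  "lev v = vdist G root v"

definition joined :: "nat \<Rightarrow> 'a \<Rightarrow> 'a \<Rightarrow> bool" where
  "joined n u v \<longleftrightarrow> (\<exists>p. walk_betw G u p v \<and> (\<forall>w\<in>set p. n \<le> lev w))"

lemma lev_le: "u \<in> verts G \<Longrightarrow> v \<in> verts G \<Longrightarrow> lev v \<le> lev u + vdist G u v"
  unfolding lev_def using vdist_triangle root by blast

text \<open>
  A geodesic from the root, indexed by level.
\<close>

definition ray :: "(nat \<Rightarrow> 'a) \<Rightarrow> nat \<Rightarrow> bool" where
  "ray \<alpha> n \<longleftrightarrow> \<alpha> 0 = root \<and> (\<forall>i\<le>n. \<alpha> i \<in> verts G \<and> lev (\<alpha> i) = i) \<and>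
     (\<forall>i<n. {\<alpha> i, \<alpha> (Suc i)} \<in> edges G) \<and> (\<forall>j\<le>n. \<forall>i\<le>j. vdist G (\<alpha> i) (\<alpha> j) \<le> j - i)"

lemma ex_ray:
  assumes "v \<in> verts G"
  shows "\<exists>\<alpha>. ray \<alpha> (lev v) \<and> \<alpha> (lev v) = v"
proof -
  obtain g where g: "walk_betw G root g v" "len g = vdist G root v" by (rule ex_geodesic[OF root assms])
  have wg: "walk G g" and ne: "g \<noteq> []" using g by (auto simp: walk_betw_def walk_def)
  have l: "length g = Suc (lev v)" using ne g(2) unfolding lev_def by (cases g) (auto simp: len_def)
  have "ray (\<lambda>i. g ! i) (lev v)"
    unfolding ray_def
  proof (intro conjI allI impI)
    show "g ! 0 = root" using g ne by (simp add: walk_betw_def hd_conv_nth)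
    show "g ! i \<in> verts G" "lev (g ! i) = i" if "i \<le> lev v" for i
      using that l vdist_on_geodesic(1)[OF g, of i] wg nth_mem[of i g] unfolding lev_def walk_def by auto
    show "{g ! i, g ! Suc i} \<in> edges G" if "i < lev v" for i
      using walk_edge_nth[OF wg] l that by simp
    show "vdist G (g ! i) (g ! j) \<le> j - i" if "j \<le> lev v" "i \<le> j" for i j
      using vdist_walk[OF wg] l that by simp
  qed
  moreover have "g ! lev v = v" using g ne l by (simp add: walk_betw_def last_conv_nth)
  ultimately show ?thesis by blast
qed

end

lemma walk_betw_map_upt:
  assumes "a \<le> b" "\<And>i. a \<le> i \<Longrightarrow> i \<le> b \<Longrightarrow> \<alpha> i \<in> verts G"
    "\<And>i. a \<le> i \<Longrightarrow> i < b \<Longrightarrow> {\<alpha> i, \<alpha> (Suc i)} \<in> edges G"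
  shows "walk_betw G (\<alpha> a) (map \<alpha> [a..<Suc b]) (\<alpha> b)"
proof -
  have "successively (\<lambda>u v. {u, v} \<in> edges G) (map \<alpha> [a..<Suc b])"
    unfolding successively_conv_nth
  proof (intro allI impI)
    fix i assume i: "Suc i < length (map \<alpha> [a..<Suc b])"
    then have "a + i < b" by (simp del: upt_Suc)
    then show "{map \<alpha> [a..<Suc b] ! i, map \<alpha> [a..<Suc b] ! Suc i} \<in> edges G"
      using assms(3)[of "a + i"] by (simp del: upt_Suc)
  qed
  moreover have "hd (map \<alpha> [a..<Suc b]) = \<alpha> a" using assms(1) by (simp add: hd_map del: upt_Suc)
  ultimately show ?thesis using assms by (auto simp: walk_betw_def walk_def)
qed

context rooted_sgraph
begin

text \<open>
  If the geodesics from the root to \<open>u\<close> and \<open>v\<close> separate only a bounded amount below level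
  \<open>n\<close>, the way along them is short. Otherwise they bound, with the walk above, a cycle long
  enough to have dense shortcuts, and a shortcut near a vertex \<open>x\<close> slightly below \<open>u\<close> has to
  reach the geodesic of \<open>v\<close>.
\<close>

lemma joined_close:
  assumes chordal: "densely_chordal G \<epsilon> k m"
    and uv: "u \<in> verts G" "v \<in> verts G" "lev u = n" "lev v = n" "joined n u v"
  shows "vdist G u v \<le> 4 * (nat \<lceil>\<epsilon>\<rceil> + m + k + 1)"
proof (cases "u = v")
  case True
  then show ?thesis using uv by simp
next
  case False
  define e where "e = nat \<lceil>\<epsilon>\<rceil>"
  \<comment> \<open>A shortcut of length at most \<open>m\<close> that starts within \<open>e\<close> of a vertex of level \<open>n - R\<close> cannot
    reach level \<open>n\<close>.\<close>
  define R where "R = e + m + 1"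
  obtain \<alpha> where "ray \<alpha> n" "\<alpha> n = u" using ex_ray[OF uv(1)] uv(3) by auto
  then have \<alpha>: "\<alpha> 0 = root" "\<alpha> n = u" "\<And>i. i \<le> n \<Longrightarrow> \<alpha> i \<in> verts G \<and> lev (\<alpha> i) = i"
    "\<And>i. i < n \<Longrightarrow> {\<alpha> i, \<alpha> (Suc i)} \<in> edges G"
    "\<And>i j. i \<le> j \<Longrightarrow> j \<le> n \<Longrightarrow> vdist G (\<alpha> i) (\<alpha> j) \<le> j - i"
    unfolding ray_def by auto
  obtain \<beta> where "ray \<beta> n" "\<beta> n = v" using ex_ray[OF uv(2)] uv(4) by auto
  then have \<beta>: "\<beta> 0 = root" "\<beta> n = v" "\<And>i. i \<le> n \<Longrightarrow> \<beta> i \<in> verts G \<and> lev (\<beta> i) = i"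
    "\<And>i. i < n \<Longrightarrow> {\<beta> i, \<beta> (Suc i)} \<in> edges G"
    "\<And>i j. i \<le> j \<Longrightarrow> j \<le> n \<Longrightarrow> vdist G (\<beta> i) (\<beta> j) \<le> j - i"
    unfolding ray_def by auto
  \<comment> \<open>Above level \<open>j\<close> the two geodesics are disjoint: equal vertices have equal levels.\<close>
  define j where "j = Max {i. i \<le> n \<and> \<alpha> i = \<beta> i}"
  have fin: "finite {i. i \<le> n \<and> \<alpha> i = \<beta> i}" by (rule finite_subset[of _ "{..n}"]) auto
  have "j \<in> {i. i \<le> n \<and> \<alpha> i = \<beta> i}"
    unfolding j_def using fin \<alpha>(1) \<beta>(1) by (intro Max_in) auto
  then have j: "j \<le> n" "\<alpha> j = \<beta> j" by auto
  have jmax: "\<alpha> i \<noteq> \<beta> i" if "j < i" "i \<le> n" for i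
  proof
    assume "\<alpha> i = \<beta> i"
    then have "i \<le> j" unfolding j_def using fin that by (intro Max_ge) auto
    then show False using that by simp
  qed
  have "j < n" using j False \<alpha>(2) \<beta>(2) by (cases "j = n") auto
  show ?thesis
  proof (cases "n - j \<le> R + k")
    case True
    have "vdist G u v \<le> vdist G u (\<alpha> j) + vdist G (\<alpha> j) v"
      using vdist_triangle \<alpha>(3) j(1) uv(1,2) by blast
    moreover have "vdist G u (\<alpha> j) \<le> n - j" using \<alpha>(2) \<alpha>(3)[of j] \<alpha>(5)[of j n] j vdist_commute[of u "\<alpha> j"] uv(1) by simp
    moreover have "vdist G (\<alpha> j) v \<le> n - j" using \<beta>(2) \<beta>(5)[of j n] j by simp
    ultimately show ?thesis using True by (simp add: R_def e_def)
  next
    case far: False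
    obtain P\<^sub>0 where P\<^sub>0: "walk_betw G u P\<^sub>0 v" "\<forall>w\<in>set P\<^sub>0. n \<le> lev w"
      using uv(5) unfolding joined_def by blast
    then obtain P where P: "walk_betw G u P v" "distinct P" "\<forall>w\<in>set P. n \<le> lev w"
      using walk_betw_simple_path[OF P\<^sub>0(1)] by blast
    then obtain P' where P': "P = u # P'" by (cases P) (auto simp: walk_betw_def walk_def)
    \<comment> \<open>The cycle climbs the first geodesic from its level \<open>j\<close>, follows the walk above level \<open>n\<close>, and
      comes down the second geodesic.\<close>
    define A where "A = map \<alpha> [j..<Suc n]"
    define B where "B = rev (map \<beta> [j..<n])"
    define c where "c = A @ P' @ B"
    have "walk_betw G (\<alpha> j) A u"
      unfolding A_def \<alpha>(2)[symmetric] using j(1) \<alpha> by (intro walk_betw_map_upt) auto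
    moreover have "walk_betw G v (rev (map \<beta> [j..<Suc n])) (\<beta> j)"
      unfolding \<beta>(2)[symmetric] using j(1) \<beta> by (intro walk_betw_rev walk_betw_map_upt) auto
    moreover have "tl (rev (map \<beta> [j..<Suc n])) = B" using j(1) by (simp add: B_def)
    ultimately have "walk_betw G (\<alpha> j) (A @ tl P) v" "walk_betw G (\<alpha> j) ((A @ tl P) @ B) (\<beta> j)"
      using walk_betw_append[OF _ P(1)] walk_betw_append by metis+
    then have wc: "walk_betw G (\<alpha> j) c (\<alpha> j)" unfolding c_def P' j(2) by simp
    have setA: "set A = \<alpha> ` {j..n}" and setB: "set B = \<beta> ` {j..<n}"
      by (auto simp: A_def B_def simp del: upt_Suc)
    have lenA: "length A = Suc n - j" and lenB: "length B = n - j"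
      by (simp_all add: A_def B_def del: upt_Suc)
    have lenc: "length c = (Suc n - j) + length P' + (n - j)" by (simp add: c_def lenA lenB)
    have "P' \<noteq> []" using P(1) P' False by (auto simp: walk_betw_def)
    have above: "n \<le> lev w" "w \<noteq> u" if "w \<in> set P'" for w using P P' that by auto
    have "distinct (tl c)"
    proof -
      have tlA: "tl A = map \<alpha> [Suc j..<Suc n]" using j(1) by (simp add: A_def upt_conv_Cons del: upt_Suc)
      have "inj_on \<alpha> {Suc j..<Suc n}" using \<alpha>(3) by (intro inj_on_inverseI[of _ lev]) auto
      moreover have "inj_on \<beta> {j..<n}" using \<beta>(3) by (intro inj_on_inverseI[of _ lev]) auto
      moreover have "\<alpha> i \<notin> set P'" if "i \<in> {Suc j..<Suc n}" for i
        using above[of "\<alpha> i"] \<alpha>(2) \<alpha>(3)[of i] that by (cases "i = n") auto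
      moreover have "\<beta> i \<notin> set P'" if "i \<in> {j..<n}" for i
        using above(1)[of "\<beta> i"] \<beta>(3)[of i] that by auto
      moreover have "\<alpha> i \<noteq> \<beta> i'" if "i \<in> {Suc j..<Suc n}" "i' \<in> {j..<n}" for i i'
        using \<alpha>(3)[of i] \<beta>(3)[of i'] jmax[of i] that by (cases "i = i'") auto
      moreover have "tl c = tl A @ P' @ B" using lenA j(1) by (cases A) (auto simp: c_def)
      ultimately show ?thesis using P(2) P'
        by (auto simp: tlA B_def distinct_map simp del: upt_Suc)
    qed
    then have cyc: "cycle G c"
      using wc lenc \<open>j < n\<close> \<open>P' \<noteq> []\<close> by (cases P') (auto simp: cycle_def walk_betw_def)
    have "k \<le> len c" using lenc far by (simp add: len_def)
    then obtain S where S: "\<forall>s\<in>S. strict_shortcut G c s \<and> len s \<le> m"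
      "eps_dense \<epsilon> (\<Union>s\<in>S. {vpt (hd s), vpt (last s)}) (points (trace_graph c)) (gdist (trace_graph c))"
      using chordal[unfolded densely_chordal_def, rule_format, of c] cyc by blast
    have walkc: "walk G c" using wc by (simp add: walk_betw_def)
    interpret C: connected_sgraph "trace_graph c" using connected_trace[OF walkc] .
    define x where "x = \<alpha> (n - R)"
    have x: "x \<in> set c" "x \<in> verts G" "lev x = n - R" "vdist G u x \<le> R"
      using far \<alpha>(2) \<alpha>(3)[of "n - R"] \<alpha>(5)[of "n - R" n] vdist_commute[of u x] uv(1) setA
      by (auto simp: x_def c_def)
    have "vpt x \<in> points (trace_graph c)" using vpt_points[of x "trace_graph c"] x(1) by simp
    then obtain s where s: "s \<in> S" and "gdist (trace_graph c) (vpt (hd s)) (vpt x) < \<epsilon> \<or>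
        gdist (trace_graph c) (vpt (last s)) (vpt x) < \<epsilon>"
      using S(2) unfolding eps_dense_def by blast
    then obtain p q where pq: "p = hd s \<and> q = last s \<or> p = last s \<and> q = hd s"
      and xp: "gdist (trace_graph c) (vpt p) (vpt x) < \<epsilon>"
      by blast
    have sc: "walk_betw G (hd s) s (last s)" "hd s \<in> set c" "last s \<in> set c"
      "real (len s) < gdist (trace_graph c) (vpt (hd s)) (vpt (last s))" "len s \<le> m"
      using bspec[OF S(1) s] by (auto simp: strict_shortcut_def shortcut_def simple_path_walk_betw)
    have pqc: "p \<in> set c" "q \<in> set c" and pqG: "p \<in> verts G" "q \<in> verts G"
      using pq sc(2,3) walkc unfolding walk_def by auto
    have pq_dist: "vdist G p q \<le> len s" "len s < vdist (trace_graph c) p q"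
    proof -
      have "vdist G (hd s) (last s) \<le> len s" "len s < vdist (trace_graph c) (hd s) (last s)"
        using vdist_le[OF sc(1)] sc(2-4) C.gdist_vpt[of "hd s" "last s"] by auto
      then show "vdist G p q \<le> len s" "len s < vdist (trace_graph c) p q"
        using pq pqc vdist_commute[OF pqG] C.vdist_commute[of p q] by auto
    qed
    have "real (vdist (trace_graph c) p x) < \<epsilon>" using xp C.gdist_vpt[of p x] pqc x(1) by simp
    then have "vdist (trace_graph c) p x \<le> e" unfolding e_def by linarith
    then have px: "vdist G x p \<le> e"
      using vdist_le_vdist_trace[OF walkc pqc(1) x(1)] vdist_commute[OF x(2) pqG(1)] by simp
    have xq: "vdist G x q \<le> e + m" using vdist_triangle[OF x(2) pqG] px pq_dist(1) sc(5) by linarith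
    have low: "\<exists>i. j \<le> i \<and> i < n \<and> (z = \<alpha> i \<or> z = \<beta> i)"
      if z: "z \<in> set c" "z \<in> verts G" "vdist G x z \<le> e + m" for z
    proof -
      have "lev z < n" using lev_le[OF x(2) z(2)] z(3) x(3) far by (simp add: R_def)
      then consider i where "j \<le> i" "i \<le> n" "z = \<alpha> i" | i where "j \<le> i" "i < n" "z = \<beta> i"
        using z(1) above(1)[of z] unfolding c_def by (auto simp: setA setB)
      then show ?thesis
      proof cases
        case 1
        then have "i < n" using \<open>lev z < n\<close> \<alpha>(3)[of i] by simp
        then show ?thesis using 1 by blast
      next
        case 2
        then show ?thesis by blast
      qed
    qed
    \<comment> \<open>Otherwise both ends of the shortcut lie on the first geodesic, where the way along the cycle
      is already shortest in the graph.\<close>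
    have "\<exists>z\<in>{p, q}. \<exists>i\<le>n. z = \<beta> i"
    proof (rule ccontr)
      assume no: "\<not> (\<exists>z\<in>{p, q}. \<exists>i\<le>n. z = \<beta> i)"
      obtain i where i: "j \<le> i" "i < n" "p = \<alpha> i"
        using low[OF pqc(1) pqG(1)] px no by (meson insertI1 less_imp_le trans_le_add1)
      obtain i' where i': "j \<le> i'" "i' < n" "q = \<alpha> i'"
        using low[OF pqc(2) pqG(2)] xq no by (meson insertI1 insertI2 less_imp_le)
      have on_c: "\<alpha> l = c ! (l - j)" if "j \<le> l" "l \<le> n" for l
      proof -
        have "l - j < length A" using that unfolding lenA by linarith
        then show ?thesis using that by (simp add: c_def nth_append A_def del: upt_Suc)
      qed
      have "vdist (trace_graph c) (\<alpha> a) (\<alpha> b) \<le> b - a" if "j \<le> a" "a \<le> b" "b \<le> n" for a b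
        using C.vdist_walk[OF walk_trace[OF walkc], of "a - j" "b - j"] that on_c lenc by simp
      then have "vdist (trace_graph c) p q \<le> i' - i \<or> vdist (trace_graph c) q p \<le> i - i'"
        using i i' by (cases "i \<le> i'") simp_all
      then have "vdist (trace_graph c) p q \<le> max (i - i') (i' - i)"
        using C.vdist_commute[of p q] pqc by auto
      moreover have "lev p = i" "lev q = i'" using \<alpha>(3) i i' by simp_all
      then have "i - i' \<le> vdist G p q" "i' - i \<le> vdist G p q"
        using lev_le[OF pqG] lev_le[OF pqG(2,1)] vdist_commute[OF pqG] by linarith+
      ultimately show False using pq_dist by linarith
    qed
    then obtain z i where z: "z \<in> {p, q}" "i \<le> n" "z = \<beta> i" by blast
    have xz: "vdist G x z \<le> e + m" using z(1) px xq by auto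
    have zG: "z \<in> verts G" using z pqG by auto
    have "lev x \<le> lev z + (e + m)" using lev_le[OF zG x(2)] xz vdist_commute[OF zG x(2)] by simp
    then have "n - i \<le> R + e + m" using x(3) z \<beta>(3)[of i] by simp
    then have "vdist G z v \<le> R + e + m" using \<beta>(2) \<beta>(5)[of i n] z by simp
    moreover have "vdist G u v \<le> vdist G u x + (vdist G x z + vdist G z v)"
      using vdist_triangle[OF uv(1) x(2) uv(2)] vdist_triangle[OF x(2) zG uv(2)] by linarith
    ultimately show ?thesis using x(4) xz by (simp add: R_def e_def)
  qed
qed

end


section \<open>The tree of layers\<close>

text \<open>
  At a vertex of a cycle where \<open>h\<close> is largest, both neighbours along the cycle would be
  parents, and they are different.
\<close>

lemma no_cycle_if_unique_parent:
  fixes h :: "'a \<Rightarrow> nat"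
  assumes neq: "\<And>a b. {a, b} \<in> edges T \<Longrightarrow> h a \<noteq> h b"
    and parent: "\<And>a b b'. \<lbrakk>{a, b} \<in> edges T; {a, b'} \<in> edges T; h b < h a; h b' < h a\<rbrakk> \<Longrightarrow> b = b'"
  shows "\<not> cycle T c"
proof
  assume c: "cycle T c"
  then have w: "walk T c" and L: "3 \<le> len c" and len: "length c = Suc (len c)"
    by (auto simp: cycle_def len_def)
  let ?H = "(\<lambda>i. h (c ! i)) ` {0<..len c}"
  have "Max ?H \<in> ?H" using L by (intro Max_in) auto
  then obtain i where i: "0 < i" "i \<le> len c" "h (c ! i) = Max ?H" by auto
  have max: "h (c ! j) \<le> h (c ! i)" if "j \<le> len c" for j
  proof (cases "j = 0")
    case True
    then have "h (c ! j) = h (c ! len c)" using cycle_closed[OF c] by simp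
    also have "\<dots> \<le> Max ?H" using L by (intro Max_ge) auto
    finally show ?thesis by (simp add: i(3))
  next
    case False
    then show ?thesis unfolding i(3) using that by (intro Max_ge) auto
  qed
  \<comment> \<open>The last vertex of the list repeats the first, so its successor on the cycle has index 1.\<close>
  define s where "s = (if i = len c then 1 else Suc i)"
  have e: "{c ! i, c ! (i - 1)} \<in> edges T" "{c ! i, c ! s} \<in> edges T"
    using walk_edge_nth[OF w, of "i - 1"] walk_edge_nth[OF w, of "if i = len c then 0 else i"]
      i L len cycle_closed[OF c] by (auto simp: s_def insert_commute split: if_splits)
  have "h (c ! (i - 1)) < h (c ! i)" "h (c ! s) < h (c ! i)"
  proof -
    have "s \<le> len c" "i - 1 \<le> len c" using i(2) L by (auto simp: s_def)
    then show "h (c ! (i - 1)) < h (c ! i)" "h (c ! s) < h (c ! i)"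
      using neq[OF e(1)] neq[OF e(2)] max[of "i - 1"] max[of s] by linarith+
  qed
  from parent[OF e this] have eq: "c ! (i - 1) = c ! s" .
  define r where "r = (if i = 1 then len c else i - 1)"
  have "c ! r = c ! s" using eq cycle_closed[OF c] by (cases "i = 1") (simp_all add: r_def)
  moreover have "r \<noteq> s" "0 < r" "r \<le> len c" "0 < s" "s \<le> len c"
    using i(1,2) L unfolding r_def s_def by (auto split: if_splits)
  ultimately show False using cycle_nth_inj[OF c] by blast
qed

context rooted_sgraph
begin

definition same_layer :: "'a \<Rightarrow> 'a \<Rightarrow> bool" where
  "same_layer u v \<longleftrightarrow> lev u = lev v \<and> joined (lev u) u v"

text \<open>
  Layers are represented by one of their vertices, so that the tree of layers is a graph on the
  type of the vertices of \<open>G\<close>.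
\<close>

definition rep :: "'a \<Rightarrow> 'a" where
  "rep v = (SOME u. same_layer v u)"

definition layer_tree :: "'a sgraph" where
  "layer_tree = (rep ` verts G, {{rep u, rep v} |u v. {u, v} \<in> edges G \<and> rep u \<noteq> rep v})"

lemma verts_layer_tree [simp]: "verts layer_tree = rep ` verts G"
  and edges_layer_tree:
    "edges layer_tree = {{rep u, rep v} |u v. {u, v} \<in> edges G \<and> rep u \<noteq> rep v}"
  by (simp_all add: layer_tree_def verts_def edges_def)

lemma joined_sym: "joined n u v \<Longrightarrow> joined n v u"
  unfolding joined_def using walk_betw_rev set_rev by metis

lemma joined_trans:
  assumes "joined n u v" "joined n v w"
  shows "joined n u w"
proof -
  obtain p q where p: "walk_betw G u p v" "\<forall>x\<in>set p. n \<le> lev x"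
    and q: "walk_betw G v q w" "\<forall>x\<in>set q. n \<le> lev x"
    using assms unfolding joined_def by blast
  have "set (p @ tl q) \<subseteq> set p \<union> set q" by (cases q) auto
  then show ?thesis using walk_betw_append[OF p(1) q(1)] p(2) q(2) unfolding joined_def by blast
qed

lemma joined_mono: "joined n u v \<Longrightarrow> m \<le> n \<Longrightarrow> joined m u v"
  unfolding joined_def by (meson order_trans)

lemma joined_edge:
  assumes "{u, v} \<in> edges G" "n \<le> lev u" "n \<le> lev v"
  shows "joined n u v"
  using walk_betw_Cons[OF walk_betw_singleton assms(1)] edge_ends[OF assms(1)] assms(2,3)
  unfolding joined_def by (intro exI[of _ "[u, v]"]) simp

lemma same_layer_refl: "v \<in> verts G \<Longrightarrow> same_layer v v"
  unfolding same_layer_def joined_def using walk_betw_singleton by fastforce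

lemma same_layer_sym: "same_layer u v \<Longrightarrow> same_layer v u"
  unfolding same_layer_def using joined_sym by metis

lemma same_layer_trans: "same_layer u v \<Longrightarrow> same_layer v w \<Longrightarrow> same_layer u w"
  unfolding same_layer_def using joined_trans by metis

lemma same_layer_rep: "v \<in> verts G \<Longrightarrow> same_layer v (rep v)"
  unfolding rep_def using same_layer_refl by (rule someI)

lemma rep_eq:
  assumes "same_layer u v"
  shows "rep u = rep v"
proof -
  have "same_layer u = same_layer v"
    using assms same_layer_sym same_layer_trans by blast
  then show ?thesis by (simp add: rep_def)
qed

lemma lev_rep: "v \<in> verts G \<Longrightarrow> lev (rep v) = lev v"
  using same_layer_rep by (simp add: same_layer_def)

lemma rep_in_verts: "v \<in> verts G \<Longrightarrow> rep v \<in> verts G"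
  using same_layer_rep walk_betw_ends(4) unfolding same_layer_def joined_def by metis

lemma layer_tree_edgeE:
  assumes "{a, b} \<in> edges layer_tree"
  obtains u v where "{u, v} \<in> edges G" "a = rep u" "b = rep v" "a \<noteq> b"
proof -
  obtain u v where uv: "{a, b} = {rep u, rep v}" "{u, v} \<in> edges G" "rep u \<noteq> rep v"
    using assms unfolding edges_layer_tree by blast
  then consider "a = rep u" "b = rep v" | "a = rep v" "b = rep u" by (auto simp: doubleton_eq_iff)
  then show ?thesis using that[of u v] that[of v u] uv by cases (auto simp: insert_commute)
qed

lemma lev_edge_layer_tree:
  assumes "{u, v} \<in> edges G" "rep u \<noteq> rep v"
  shows "lev u = Suc (lev v) \<or> lev v = Suc (lev u)"
proof -
  have "lev u \<noteq> lev v"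
    using joined_edge[OF assms(1)] rep_eq assms(2) unfolding same_layer_def by force
  moreover have "lev v \<le> lev u + 1" "lev u \<le> lev v + 1"
    using lev_le vdist_edge[OF assms(1)] vdist_commute edge_ends[OF assms(1)] by (metis add_left_mono order_trans)+
  ultimately show ?thesis by linarith
qed

text \<open>
  Two neighbours one level below the same layer are joined by going up into it and back, so a layer
  has only one neighbouring layer below it.
\<close>

lemma layer_tree_parent:
  assumes "{a, b} \<in> edges layer_tree" "{a, b'} \<in> edges layer_tree" "lev b < lev a" "lev b' < lev a"
  shows "b = b'"
proof -
  obtain u v where uv: "{u, v} \<in> edges G" "a = rep u" "b = rep v" "a \<noteq> b"
    using assms(1) by (rule layer_tree_edgeE)
  obtain u' v' where uv': "{u', v'} \<in> edges G" "a = rep u'" "b' = rep v'" "a \<noteq> b'"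
    using assms(2) by (rule layer_tree_edgeE)
  have V: "u \<in> verts G" "v \<in> verts G" "u' \<in> verts G" "v' \<in> verts G"
    using edge_ends[OF uv(1)] edge_ends[OF uv'(1)] by auto
  have l: "lev u = Suc (lev v)" "lev u' = Suc (lev v')" "lev u = lev u'"
    using lev_edge_layer_tree[OF uv(1)] lev_edge_layer_tree[OF uv'(1)] uv uv' assms(3,4) V
      lev_rep[of u] lev_rep[of u'] lev_rep[of v] lev_rep[of v'] by auto
  have "same_layer u u'"
    using same_layer_rep[OF V(1)] same_layer_rep[OF V(3)] uv(2) uv'(2) same_layer_sym same_layer_trans
    by metis
  then have "joined (lev v) u u'" unfolding same_layer_def using l joined_mono by simp
  moreover have "joined (lev v) v u" "joined (lev v) u' v'"
    using joined_edge[of v u "lev v"] joined_edge[of u' v' "lev v"] uv(1) uv'(1) l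
    by (simp_all add: insert_commute)
  ultimately have "same_layer v v'" unfolding same_layer_def using l joined_trans by (metis Suc_inject)
  then show ?thesis using rep_eq uv uv' by simp
qed

lemma layer_tree_walk:
  assumes "walk_betw G u p v"
  shows "\<exists>q. walk_betw layer_tree (rep u) q (rep v) \<and> len q \<le> len p"
  using assms
proof (induction rule: walk_betw_induct)
  case (single u)
  then show ?case
    using walk_betw_singleton[of "rep u" layer_tree] by (intro exI[of _ "[rep u]"]) (simp add: len_def)
next
  case (step u w p v)
  obtain q where q: "walk_betw layer_tree (rep w) q (rep v)" "len q \<le> len p" using step.IH by blast
  show ?case
  proof (cases "rep u = rep w")
    case True
    then show ?thesis using q step(3) by (auto simp: len_Cons walk_betw_nonempty)
  next
    case False
    then have "{rep u, rep w} \<in> edges layer_tree" using step(1) unfolding edges_layer_tree by blast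
    from walk_betw_Cons[OF q(1) this] show ?thesis
      using q step(2,3) by (auto simp: len_Cons walk_betw_nonempty)
  qed
qed

lemma tree_layer_tree: "tree layer_tree"
proof -
  have "simple_graph layer_tree"
    unfolding simple_graph_def
  proof
    fix e assume "e \<in> edges layer_tree"
    then obtain u v where "e = {rep u, rep v}" "rep u \<noteq> rep v" "{u, v} \<in> edges G"
      unfolding edges_layer_tree by blast
    then show "\<exists>a b. e = {a, b} \<and> a \<noteq> b \<and> a \<in> verts layer_tree \<and> b \<in> verts layer_tree"
      using edge_ends by (intro exI[of _ "rep u"] exI[of _ "rep v"]) simp
  qed
  moreover have "\<exists>q. simple_path layer_tree q \<and> hd q = a \<and> last q = b"
    if "a \<in> verts layer_tree" "b \<in> verts layer_tree" for a b
  proof -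
    obtain u v where uv: "u \<in> verts G" "v \<in> verts G" "a = rep u" "b = rep v" using \<open>a \<in> _\<close> \<open>b \<in> _\<close> by auto
    then obtain p where "walk_betw G u p v" using ex_geodesic by metis
    then obtain q where "walk_betw layer_tree a q b" using layer_tree_walk uv by blast
    then obtain q where "walk_betw layer_tree a q b" "distinct q" using walk_betw_simple_path by metis
    then show ?thesis by (auto simp: walk_betw_def simple_path_def)
  qed
  moreover have "\<not> cycle layer_tree c" for c
  proof (rule no_cycle_if_unique_parent[of _ lev])
    show "lev a \<noteq> lev b" if "{a, b} \<in> edges layer_tree" for a b
      using that lev_edge_layer_tree lev_rep edge_ends by (elim layer_tree_edgeE) (metis n_not_Suc_n)
  qed (rule layer_tree_parent)
  ultimately show ?thesis using root unfolding tree_def connected_graph_def by auto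
qed

text \<open>
  Each edge of the tree comes from an edge of the graph whose ends lie in the two layers, hence
  within the diameter bound of the two representatives.
\<close>

lemma vdist_le_layer_tree_walk:
  assumes close: "\<And>u v. same_layer u v \<Longrightarrow> u \<in> verts G \<Longrightarrow> v \<in> verts G \<Longrightarrow> vdist G u v \<le> \<Delta>"
    and "walk_betw layer_tree a q b"
  shows "vdist G a b \<le> (2 * \<Delta> + 1) * len q"
  using assms(2)
proof (induction rule: walk_betw_induct)
  case (single a)
  then show ?case using rep_in_verts by (auto simp: len_def)
next
  case (step a w q b)
  obtain u v where uv: "{u, v} \<in> edges G" "a = rep u" "w = rep v"
    using step(1) by (rule layer_tree_edgeE)
  have V: "u \<in> verts G" "v \<in> verts G" "a \<in> verts G" "w \<in> verts G" "b \<in> verts G"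
    using edge_ends[OF uv(1)] uv rep_in_verts walk_betw_ends(4)[OF step(3)] by auto
  have "vdist G u a \<le> \<Delta>" "vdist G v w \<le> \<Delta>" using close same_layer_rep V uv by auto
  then have "vdist G a w \<le> 2 * \<Delta> + 1"
    using vdist_triangle[OF V(3,1,4)] vdist_triangle[OF V(1,2,4)] vdist_edge[OF uv(1)]
      vdist_commute[OF V(3,1)] by linarith
  then have "vdist G a b \<le> (2 * \<Delta> + 1) + (2 * \<Delta> + 1) * len q"
    using vdist_triangle[OF V(3,4,5)] step.IH by linarith
  then show ?case using step(3) by (simp add: len_Cons walk_betw_nonempty algebra_simps)
qed

text \<open>
  A point is moved to a nearby vertex and then to the representative of its layer. Walks in the
  graph project to walks in the tree that are not longer, which bounds distances in the tree from
  above; walks in the tree are followed through the representatives in the graph, which bounds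
  them from below.
\<close>

lemma quasi_isometric_layer_tree:
  assumes close: "\<And>u v. same_layer u v \<Longrightarrow> u \<in> verts G \<Longrightarrow> v \<in> verts G \<Longrightarrow> vdist G u v \<le> \<Delta>"
  shows "quasi_isometric_graphs G layer_tree"
proof -
  interpret T: connected_sgraph layer_tree
    using tree_layer_tree by unfold_locales (simp add: tree_def)
  define r where "r x = (SOME v. v \<in> verts G \<and> gdist G x (vpt v) \<le> 1)" for x
  have r: "r x \<in> verts G" "gdist G x (vpt (r x)) \<le> 1" if "x \<in> points G" for x
  proof -
    have "\<exists>v. v \<in> verts G \<and> gdist G x (vpt v) \<le> 1" using gdist_near_vertex[OF that] by metis
    from someI_ex[OF this] show "r x \<in> verts G" "gdist G x (vpt (r x)) \<le> 1" by (auto simp: r_def)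
  qed
  define f where "f x = vpt (rep (r x))" for x
  have fT: "f x \<in> points layer_tree" if "x \<in> points G" for x
    using r(1)[OF that] by (simp add: f_def vpt_points)
  have le: "vdist layer_tree (rep u) (rep v) \<le> vdist G u v" if uv: "u \<in> verts G" "v \<in> verts G" for u v
  proof -
    obtain p where "walk_betw G u p v" "len p = vdist G u v" using ex_geodesic[OF uv] by metis
    then show ?thesis using layer_tree_walk vdist_le by (metis order_trans)
  qed
  have ge: "vdist G u v \<le> 2 * \<Delta> + (2 * \<Delta> + 1) * vdist layer_tree (rep u) (rep v)"
    if uv: "u \<in> verts G" "v \<in> verts G" for u v
  proof -
    have V: "rep u \<in> verts G" "rep v \<in> verts G" using rep_in_verts uv by auto
    obtain q where q: "walk_betw layer_tree (rep u) q (rep v)" "len q = vdist layer_tree (rep u) (rep v)"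
      using T.ex_geodesic[of "rep u" "rep v"] uv by auto
    have "vdist G u (rep u) \<le> \<Delta>" "vdist G v (rep v) \<le> \<Delta>" using close same_layer_rep V uv by auto
    then show ?thesis
      using vdist_le_layer_tree_walk[OF close q(1)] q(2) vdist_triangle[OF uv(1) V(1) uv(2)]
        vdist_triangle[OF V uv(2)] vdist_commute[OF uv(2) V(2)] by simp
  qed
  define M where "M = real (2 * \<Delta> + 1)"
  have M: "1 \<le> M" by (simp add: M_def)
  have fd: "gdist layer_tree (f x) (f y) = real (vdist layer_tree (rep (r x)) (rep (r y)))"
    if "x \<in> points G" "y \<in> points G" for x y
    using r(1) that by (simp add: f_def T.gdist_vpt)
  have upper: "gdist layer_tree (f x) (f y) \<le> M * gdist G x y + (M + 3)"
    and lower: "1 / M * gdist G x y - (M + 3) \<le> gdist layer_tree (f x) (f y)"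
    if xy: "x \<in> points G" "y \<in> points G" for x y
  proof -
    have R: "r x \<in> verts G" "r y \<in> verts G" using r(1) xy by auto
    note P = vpt_points[OF R(1)] vpt_points[OF R(2)]
    have d: "gdist G (vpt (r x)) (vpt (r y)) = real (vdist G (r x) (r y))" using gdist_vpt[OF R] .
    have 1: "gdist G (vpt (r x)) (vpt (r y)) \<le> gdist G x y + 2"
      using gdist_triangle[OF P(1) xy(1) P(2)] gdist_triangle[OF xy P(2)]
        r(2)[OF xy(1)] r(2)[OF xy(2)] gdist_commute[of G x "vpt (r x)"] by linarith
    have 2: "gdist G x y \<le> gdist G (vpt (r x)) (vpt (r y)) + 2"
      using gdist_triangle[OF xy(1) P(1) xy(2)] gdist_triangle[OF P xy(2)]
        r(2)[OF xy(1)] r(2)[OF xy(2)] gdist_commute[of G y "vpt (r y)"] by linarith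
    have nn: "0 \<le> gdist G x y" using gdist_nonneg xy by blast
    have "gdist layer_tree (f x) (f y) \<le> gdist G x y + 2"
      using 1 d fd[OF xy] le[OF R] by simp
    moreover have "gdist G x y \<le> M * gdist G x y" using M nn mult_right_mono[of 1 M] by fastforce
    ultimately show "gdist layer_tree (f x) (f y) \<le> M * gdist G x y + (M + 3)" using M by linarith
    have "real (vdist G (r x) (r y)) \<le> (M - 1) + M * gdist layer_tree (f x) (f y)"
    proof -
      have "real (vdist G (r x) (r y)) \<le>
          real (2 * \<Delta> + (2 * \<Delta> + 1) * vdist layer_tree (rep (r x)) (rep (r y)))"
        using ge[OF R] by (rule of_nat_mono)
      then show ?thesis unfolding fd[OF xy] M_def by (simp add: algebra_simps)
    qed
    then have "gdist G x y \<le> M * (gdist layer_tree (f x) (f y) + (M + 3))"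
    proof -
      have "M * (gdist layer_tree (f x) (f y) + (M + 3)) = M * gdist layer_tree (f x) (f y) + M * M + 3 * M"
        by (simp add: algebra_simps)
      moreover have "0 \<le> M * M" by simp
      ultimately show ?thesis using 2 d M \<open>real _ \<le> _\<close> by linarith
    qed
    then show "1 / M * gdist G x y - (M + 3) \<le> gdist layer_tree (f x) (f y)"
      using M by (simp add: field_simps)
  qed
  have dense: "(INF z\<in>f ` points G. gdist layer_tree y z) \<le> 2" if y: "y \<in> points layer_tree" for y
  proof -
    obtain a where a: "a \<in> verts layer_tree" "gdist layer_tree y (vpt a) \<le> 1"
      using T.gdist_near_vertex[OF y] by metis
    then obtain v where v: "v \<in> verts G" "a = rep v" by auto
    have pv: "vpt v \<in> points G" using vpt_points[OF v(1)] .
    have "gdist G (vpt v) (vpt (r (vpt v))) \<le> 1" using r(2)[OF pv] .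
    then have "vdist layer_tree a (rep (r (vpt v))) \<le> 1"
      using gdist_vpt[OF v(1) r(1)[OF pv]] le[OF v(1) r(1)[OF pv]] v(2) by simp
    then have "gdist layer_tree (vpt a) (f (vpt v)) \<le> 1"
      using T.gdist_vpt[OF a(1), of "rep (r (vpt v))"] r(1)[OF pv] by (simp add: f_def)
    then have "gdist layer_tree y (f (vpt v)) \<le> 2"
      using T.gdist_triangle[OF y vpt_points[OF a(1)] fT[OF pv]] a(2) by linarith
    moreover have "bdd_below (gdist layer_tree y ` (f ` points G))"
      using T.gdist_nonneg[OF y] fT by (intro bdd_belowI[of _ 0]) auto
    ultimately show ?thesis using cINF_lower[of "gdist layer_tree y" "f ` points G" "f (vpt v)"] pv by force
  qed
  have "quasi_isometry (points G) (gdist G) (points layer_tree) (gdist layer_tree) f"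
    unfolding quasi_isometry_def
    by (rule conjI, use fT in blast, rule exI[of _ M], rule exI[of _ "M + 3"], rule exI[of _ 2])
      (use M upper lower dense in auto)
  then show ?thesis unfolding quasi_isometric_graphs_def by blast
qed

end

theorem chordal_imp_quasi_isometric_tree:
  fixes G :: "'a sgraph"
  assumes "connected_graph G" "densely_chordal G \<epsilon> k m"
  shows "\<exists>T :: 'a sgraph. tree T \<and> quasi_isometric_graphs G T"
proof -
  obtain root where "root \<in> verts G" using assms(1) unfolding connected_graph_def by blast
  then interpret rooted_sgraph G root using assms(1) by unfold_locales
  have "quasi_isometric_graphs G layer_tree"
  proof (rule quasi_isometric_layer_tree)
    show "vdist G u v \<le> 4 * (nat \<lceil>\<epsilon>\<rceil> + m + k + 1)"
      if "same_layer u v" "u \<in> verts G" "v \<in> verts G" for u v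
      using that(1) unfolding same_layer_def by (intro joined_close[OF assms(2) that(2,3)]) auto
  qed
  then show ?thesis using tree_layer_tree by blast
qed


section \<open>Trees and coarse trees\<close>

definition del_edge :: "'a sgraph \<Rightarrow> 'a set \<Rightarrow> 'a sgraph" where
  "del_edge G e = (verts G, edges G - {e})"

lemma verts_del_edge [simp]: "verts (del_edge G e) = verts G"
  and edges_del_edge [simp]: "edges (del_edge G e) = edges G - {e}"
  by (simp_all add: del_edge_def verts_def edges_def)

lemma walk_betw_del_edge:
  assumes "walk_betw G u p v" "a \<notin> set p \<or> b \<notin> set p"
  shows "walk_betw (del_edge G {a, b}) u p v"
proof -
  have "{p ! i, p ! Suc i} \<noteq> {a, b}" if "Suc i < length p" for i
    using assms(2) that nth_mem[OF that] nth_mem[of i p] by (auto simp: doubleton_eq_iff)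
  then have "successively (\<lambda>u v. {u, v} \<in> edges (del_edge G {a, b})) p"
    using assms(1) walk_edge_nth[of G p] unfolding walk_betw_def successively_conv_nth by auto
  then show ?thesis using assms(1) by (simp add: walk_betw_def walk_def)
qed

text \<open>
  Another connection between the ends of an edge would close up with the edge to a cycle.
\<close>

lemma tree_edge_bridge:
  assumes "tree T" "{a, b} \<in> edges T"
  shows "\<not> walk_betw (del_edge T {a, b}) a p b"
proof
  assume "walk_betw (del_edge T {a, b}) a p b"
  then obtain q where q: "walk_betw (del_edge T {a, b}) a q b" "distinct q"
    using walk_betw_simple_path by metis
  interpret connected_sgraph T using assms(1) by unfold_locales (simp add: tree_def)
  have ab: "a \<noteq> b" "a \<in> verts T" "b \<in> verts T" using edge_ends[OF assms(2)] by auto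
  have "walk_betw T a q b" by (rule walk_betw_mono[OF q(1)]) auto
  moreover have "walk_betw T b [b, a] a"
    using walk_betw_Cons[OF walk_betw_singleton[OF ab(2)], of b] assms(2) ab by (simp add: insert_commute)
  ultimately have "walk_betw T a (q @ tl [b, a]) a" by (rule walk_betw_append)
  then have w: "walk_betw T a (q @ [a]) a" by simp
  obtain q' where q': "q = a # q'" using q(1) by (cases q) (auto simp: walk_betw_def walk_def)
  then obtain x q'' where q'': "q' = x # q''" using q(1) ab(1) by (cases q') (auto simp: walk_betw_def)
  then have "q'' \<noteq> []" using q(1) q' by (auto simp: walk_betw_def walk_def)
  then have "cycle T (q @ [a])"
    using w q(2) q' q'' by (cases q'') (auto simp: cycle_def walk_betw_def)
  then show False using assms(1) by (simp add: tree_def)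
qed

text \<open>
  If the walk \<open>q\<close> missed \<open>z\<close>, then \<open>z\<close> and its successor on the path \<open>p\<close> would stay connected
  after removal of the edge between them: back along \<open>p\<close> to \<open>u\<close>, along \<open>q\<close> to \<open>v\<close>, and back
  along \<open>p\<close> again.
\<close>

lemma tree_simple_path_separates:
  assumes T: "tree T" and P: "walk_betw T u p v" "distinct p" "z \<in> set p" and W: "walk_betw T u q v"
  shows "z \<in> set q"
proof (rule ccontr)
  assume z: "z \<notin> set q"
  obtain xs ys where p: "p = xs @ z # ys" using split_list[OF P(3)] by blast
  have pre: "walk_betw T u (xs @ [z]) z" and post: "walk_betw T z (z # ys) v"
    using walk_betw_split[of T u xs z ys v] P(1) unfolding p by blast+
  have "ys \<noteq> []" using post z walk_betw_ends(2)[OF W] by (auto simp: walk_betw_def)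
  then obtain z' ys' where ys: "ys = z' # ys'" by (cases ys) auto
  have e: "{z, z'} \<in> edges T" and post': "walk_betw T z' ys v"
    using post unfolding ys by (auto simp: walk_betw_def walk_def)
  let ?D = "del_edge T {z, z'}"
  have "z' \<notin> set (xs @ [z])" "z \<notin> set ys" using P(2) unfolding p ys by auto
  then have "walk_betw ?D u (xs @ [z]) z" "walk_betw ?D z' ys v" "walk_betw ?D u q v"
    using walk_betw_del_edge[OF pre, of z z'] walk_betw_del_edge[OF post', of z z']
      walk_betw_del_edge[OF W, of z z'] z by simp_all
  then have "\<exists>w. walk_betw ?D z w z'"
    using walk_betw_append walk_betw_rev by (metis (no_types))
  then show False using tree_edge_bridge[OF T e] by blast
qed

text \<open>
  The vertex \<open>z\<close> is the median of \<open>a\<close>, \<open>b\<close>, \<open>x\<close>: the point where the path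
  from \<open>x\<close> to \<open>a\<close> first meets the path from \<open>a\<close> to \<open>b\<close>.
\<close>

lemma tree_median:
  assumes T: "tree T" and "a \<in> verts T" "b \<in> verts T" "x \<in> verts T"
  shows "\<exists>z. (\<forall>p. walk_betw T a p b \<longrightarrow> z \<in> set p) \<and> (\<forall>p. walk_betw T a p x \<longrightarrow> z \<in> set p) \<and>
    (\<forall>p. walk_betw T x p b \<longrightarrow> z \<in> set p)"
proof -
  interpret connected_sgraph T using T by unfold_locales (simp add: tree_def)
  obtain P where P: "walk_betw T a P b" "distinct P" using ex_simple_geodesic assms(2,3) by metis
  obtain R where R: "walk_betw T x R a" "distinct R" using ex_simple_geodesic assms(2,4) by metis
  have "\<exists>z\<in>set R. z \<in> set P" using walk_betw_ends(1)[OF P(1)] walk_betw_ends(2)[OF R(1)] by blast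
  then obtain rs z rs' where R': "R = rs @ z # rs'" "z \<in> set P" "\<forall>y\<in>set rs. y \<notin> set P"
    using split_list_first_prop[of R "\<lambda>z. z \<in> set P"] by blast
  obtain ps ps' where P': "P = ps @ z # ps'" using split_list[OF R'(2)] by blast
  have Q: "walk_betw T x (rs @ z # ps') b"
    using R(1) P(1) walk_betw_split[of T x rs z rs' a] walk_betw_split[of T a ps z ps' b]
      walk_betw_split[of T x rs z ps' b] unfolding R'(1) P' by blast
  have "distinct (rs @ z # ps')" using P(2) R(2) R'(3) unfolding R'(1) P' by auto
  moreover have "z \<in> set (rs @ z # ps')" by simp
  ultimately have "\<forall>p. walk_betw T x p b \<longrightarrow> z \<in> set p"
    using tree_simple_path_separates[OF T Q] by blast
  moreover have "\<forall>p. walk_betw T a p b \<longrightarrow> z \<in> set p"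
    using tree_simple_path_separates[OF T P R'(2)] by blast
  moreover have "\<forall>p. walk_betw T a p x \<longrightarrow> z \<in> set p"
  proof (intro allI impI)
    fix p assume "walk_betw T a p x"
    then have "z \<in> set (rev p)"
      by (intro tree_simple_path_separates[OF T R _ walk_betw_rev]) (simp add: R'(1))
    then show "z \<in> set p" by simp
  qed
  ultimately show ?thesis by blast
qed

text \<open>
  The images of consecutive vertices are joined by geodesics of length at most \<open>K\<close>.
\<close>

lemma coarse_image_walk:
  assumes T: "connected_sgraph T" and F: "\<And>v. v \<in> verts G \<Longrightarrow> F v \<in> verts T"
    and step: "\<And>u v. {u, v} \<in> edges G \<Longrightarrow> vdist T (F u) (F v) \<le> K"
    and "walk_betw G u p v"
  shows "\<exists>q. walk_betw T (F u) q (F v) \<and> (\<forall>w\<in>set q. \<exists>a\<in>set p. vdist T (F a) w \<le> K)"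
  using assms(4)
proof (induction rule: walk_betw_induct)
  case (single u)
  interpret T: connected_sgraph T by (rule T)
  show ?case using F[OF single] walk_betw_singleton by (intro exI[of _ "[F u]"]) simp
next
  case (step u w p v)
  interpret T: connected_sgraph T by (rule T)
  obtain q where q: "walk_betw T (F w) q (F v)" "\<forall>x\<in>set q. \<exists>a\<in>set p. vdist T (F a) x \<le> K"
    using step.IH by blast
  obtain g where g: "walk_betw T (F u) g (F w)" "len g = vdist T (F u) (F w)"
    using T.ex_geodesic F step(2) walk_betw_ends(3)[OF step(3)] by metis
  have near: "vdist T (F u) x \<le> K" if x: "x \<in> set g" for x
  proof -
    obtain i where i: "i < length g" "x = g ! i" using x by (metis in_set_conv_nth)
    then have "vdist T (F u) x \<le> len g" using T.vdist_on_geodesic(1)[OF g i(1)] by (simp add: len_def)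
    then show ?thesis using g(2) assms(3)[OF step(1)] by simp
  qed
  have "set (g @ tl q) \<subseteq> set g \<union> set q" by (cases q) auto
  then have "\<forall>x\<in>set (g @ tl q). \<exists>a\<in>set (u # p). vdist T (F a) x \<le> K"
    using near q(2) by fastforce
  then show ?case using walk_betw_append[OF g(1) q(1)] by blast
qed

context connected_sgraph
begin

text \<open>
  Let \<open>z\<close> be the median of the images of \<open>a\<close>, \<open>b\<close>, \<open>x\<close>. The geodesics from \<open>a\<close> to
  \<open>x\<close> and from \<open>x\<close> to \<open>b\<close> and the walk \<open>p\<close> all have vertices whose images are near \<open>z\<close>,
  and these vertices are near each other. The first two of them have \<open>x\<close> between them on a
  geodesic, so they are near \<open>x\<close>, and therefore so is the vertex of \<open>p\<close>.
\<close>

lemma bottleneck: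
  assumes T: "tree T" and F: "\<And>v. v \<in> verts G \<Longrightarrow> F v \<in> verts T"
    and upper: "\<And>u v. u \<in> verts G \<Longrightarrow> v \<in> verts G \<Longrightarrow> vdist T (F u) (F v) \<le> K * vdist G u v + K"
    and lower: "\<And>u v. u \<in> verts G \<Longrightarrow> v \<in> verts G \<Longrightarrow> vdist G u v \<le> K * vdist T (F u) (F v) + K"
    and V: "a \<in> verts G" "b \<in> verts G" "x \<in> verts G"
    and between: "vdist G a x + vdist G x b = vdist G a b"
    and p: "walk_betw G a p b"
  shows "\<exists>r\<in>set p. vdist G x r \<le> 2 * (K * (4 * K) + K)"
proof -
  interpret T: connected_sgraph T using T by unfold_locales (simp add: tree_def)
  have step: "vdist T (F u) (F v) \<le> 2 * K" if e: "{u, v} \<in> edges G" for u v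
    using upper[OF edge_ends(2,3)[OF e]] mult_le_mono2[OF vdist_edge[OF e], of K] by linarith
  obtain z where z: "\<And>q. walk_betw T (F a) q (F b) \<Longrightarrow> z \<in> set q"
    "\<And>q. walk_betw T (F a) q (F x) \<Longrightarrow> z \<in> set q" "\<And>q. walk_betw T (F x) q (F b) \<Longrightarrow> z \<in> set q"
    using tree_median[OF T F[OF V(1)] F[OF V(2)] F[OF V(3)]] by blast
  have near: "\<exists>r\<in>set q. vdist T (F r) z \<le> 2 * K"
    if q: "walk_betw G u q v" and hit: "\<And>q. walk_betw T (F u) q (F v) \<Longrightarrow> z \<in> set q" for u q v
  proof -
    obtain w where "walk_betw T (F u) w (F v)" "\<forall>y\<in>set w. \<exists>r\<in>set q. vdist T (F r) y \<le> 2 * K"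
      using coarse_image_walk[of T G F "2 * K", OF T.connected_sgraph_axioms F step q] by blast
    then show ?thesis using hit by blast
  qed
  have zT: "z \<in> verts T"
  proof -
    obtain q where q: "walk_betw T (F a) q (F b)"
      using T.ex_geodesic[OF F[OF V(1)] F[OF V(2)]] by metis
    then show ?thesis using z(1)[OF q] unfolding walk_betw_def walk_def by blast
  qed
  have close: "vdist G u v \<le> K * (4 * K) + K"
    if uv: "u \<in> verts G" "v \<in> verts G" "vdist T (F u) z \<le> 2 * K" "vdist T (F v) z \<le> 2 * K" for u v
  proof -
    have "vdist T (F u) (F v) \<le> 4 * K"
      using T.vdist_triangle[OF F[OF uv(1)] zT F[OF uv(2)]] T.vdist_commute[OF zT F[OF uv(2)]] uv(3,4)
      by simp
    then have "K * vdist T (F u) (F v) \<le> K * (4 * K)" by (rule mult_left_mono) simp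
    then show ?thesis using lower[OF uv(1,2)] by linarith
  qed
  have in_verts: "w \<in> verts G" if "walk_betw G u q v" "w \<in> set q" for u q v w
    using that unfolding walk_betw_def walk_def by blast
  have on_geodesic: "vdist G u w + vdist G w v = vdist G u v"
    if g: "walk_betw G u g v" "len g = vdist G u v" and "w \<in> set g" for u g v w
  proof -
    obtain i where i: "i < length g" "w = g ! i" using \<open>w \<in> set g\<close> by (metis in_set_conv_nth)
    then show ?thesis using vdist_on_geodesic[OF g i(1)] g(2) by (auto simp: len_def)
  qed
  obtain g where g: "walk_betw G a g x" "len g = vdist G a x" by (rule ex_geodesic[OF V(1,3)])
  obtain g' where g': "walk_betw G x g' b" "len g' = vdist G x b" by (rule ex_geodesic[OF V(3,2)])
  obtain r where r: "r \<in> set p" "vdist T (F r) z \<le> 2 * K" using near[OF p z(1)] by blast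
  obtain s where s: "s \<in> set g" "vdist T (F s) z \<le> 2 * K" using near[OF g(1) z(2)] by blast
  obtain s' where s': "s' \<in> set g'" "vdist T (F s') z \<le> 2 * K" using near[OF g'(1) z(3)] by blast
  have V': "r \<in> verts G" "s \<in> verts G" "s' \<in> verts G"
    using in_verts[OF p r(1)] in_verts[OF g(1) s(1)] in_verts[OF g'(1) s'(1)] by auto
  \<comment> \<open>A geodesic from \<open>a\<close> to \<open>b\<close> runs through \<open>s\<close>, \<open>x\<close>, \<open>s'\<close> in this order.\<close>
  have "vdist G s x \<le> vdist G s s'"
    using on_geodesic[OF g s(1)] on_geodesic[OF g' s'(1)] between
      vdist_triangle[OF V(1) V'(2) V(2)] vdist_triangle[OF V'(2,3) V(2)] by linarith
  then have "vdist G x s \<le> K * (4 * K) + K"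
    using close[OF V'(2,3) s(2) s'(2)] vdist_commute[OF V(3) V'(2)] by linarith
  then have "vdist G x r \<le> 2 * (K * (4 * K) + K)"
    using close[OF V'(2,1) s(2) r(2)] vdist_triangle[OF V(3) V'(2,1)]
    unfolding mult_2 by linarith
  then show ?thesis using r(1) by blast
qed

text \<open>
  The quasi-isometry may send vertices to interior points of edges; the images are rounded to
  vertices at the cost of larger constants.
\<close>

lemma quasi_isometric_vertex_map:
  assumes T: "connected_graph T" and qi: "quasi_isometric_graphs G T"
  obtains F K where "\<And>v. v \<in> verts G \<Longrightarrow> F v \<in> verts T"
    "\<And>u v. u \<in> verts G \<Longrightarrow> v \<in> verts G \<Longrightarrow> vdist T (F u) (F v) \<le> K * vdist G u v + K"
    "\<And>u v. u \<in> verts G \<Longrightarrow> v \<in> verts G \<Longrightarrow> vdist G u v \<le> K * vdist T (F u) (F v) + K"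
proof -
  interpret T: connected_sgraph T using T by unfold_locales
  obtain f lam C where f: "f ` points G \<subseteq> points T" and lam: "1 \<le> lam" and C: "0 < C"
    and ineq: "\<forall>x\<in>points G. \<forall>y\<in>points G. 1 / lam * gdist G x y - C \<le> gdist T (f x) (f y) \<and>
      gdist T (f x) (f y) \<le> lam * gdist G x y + C"
    using qi unfolding quasi_isometric_graphs_def quasi_isometry_def by blast
  define F where "F v = (SOME w. w \<in> verts T \<and> gdist T (f (vpt v)) (vpt w) \<le> 1)" for v
  have fT: "f (vpt v) \<in> points T" if "v \<in> verts G" for v using f vpt_points[OF that] by blast
  have F: "F v \<in> verts T" "gdist T (f (vpt v)) (vpt (F v)) \<le> 1" if "v \<in> verts G" for v
  proof -
    have "\<exists>w. w \<in> verts T \<and> gdist T (f (vpt v)) (vpt w) \<le> 1"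
      using T.gdist_near_vertex[OF fT[OF that]] by metis
    from someI_ex[OF this] show "F v \<in> verts T" "gdist T (f (vpt v)) (vpt (F v)) \<le> 1"
      by (auto simp: F_def)
  qed
  define K where "K = nat \<lceil>lam * (C + 2) + lam + (C + 2)\<rceil>"
  have pos: "0 \<le> lam * (C + 2)" using lam C by simp
  then have K: "lam \<le> real K" "C + 2 \<le> real K" "lam * (C + 2) \<le> real K"
    unfolding K_def using lam C by linarith+
  show ?thesis
  proof (rule that[of F K, OF F(1)])
    fix u v assume uv: "u \<in> verts G" "v \<in> verts G"
    note P = vpt_points[OF F(1)[OF uv(1)]] vpt_points[OF F(1)[OF uv(2)]] fT[OF uv(1)] fT[OF uv(2)]
    have d: "gdist T (vpt (F u)) (vpt (F v)) = real (vdist T (F u) (F v))"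
      using T.gdist_vpt F(1) uv by simp
    have 1: "real (vdist T (F u) (F v)) \<le> gdist T (f (vpt u)) (f (vpt v)) + 2"
      using T.gdist_triangle[OF P(1,3,2)] T.gdist_triangle[OF P(3,4,2)] F(2)[OF uv(1)] F(2)[OF uv(2)]
        gdist_commute[of T "vpt (F u)" "f (vpt u)"] d by linarith
    have 2: "gdist T (f (vpt u)) (f (vpt v)) \<le> real (vdist T (F u) (F v)) + 2"
      using T.gdist_triangle[OF P(3,1,4)] T.gdist_triangle[OF P(1,2,4)] F(2)[OF uv(1)] F(2)[OF uv(2)]
        gdist_commute[of T "vpt (F v)" "f (vpt v)"] d by linarith
    have q: "1 / lam * real (vdist G u v) - C \<le> gdist T (f (vpt u)) (f (vpt v))"
      "gdist T (f (vpt u)) (f (vpt v)) \<le> lam * real (vdist G u v) + C"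
      using bspec[OF bspec[OF ineq vpt_points[OF uv(1)]] vpt_points[OF uv(2)]]
      unfolding gdist_vpt[OF uv] by blast+
    have "real (vdist T (F u) (F v)) \<le> real K * real (vdist G u v) + real K"
      using 1 q(2) mult_right_mono[OF K(1), of "real (vdist G u v)"] K(2) by linarith
    then show "vdist T (F u) (F v) \<le> K * vdist G u v + K"
      by (metis of_nat_add of_nat_le_iff of_nat_mult)
    have "1 / lam * real (vdist G u v) \<le> real (vdist T (F u) (F v)) + (C + 2)" using 2 q(1) by linarith
    then have "real (vdist G u v) \<le> lam * real (vdist T (F u) (F v)) + lam * (C + 2)"
      using lam by (simp add: field_simps)
    then have "real (vdist G u v) \<le> real K * real (vdist T (F u) (F v)) + real K"
      using mult_right_mono[OF K(1), of "real (vdist T (F u) (F v))"] K(3) by linarith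
    then show "vdist G u v \<le> K * vdist T (F u) (F v) + K"
      by (metis of_nat_add of_nat_le_iff of_nat_mult)
  qed
qed

end


section \<open>Strict shortcuts from short paths\<close>

text \<open>
  The support of the barycentric coordinates recovers the vertex or the edge on which a point lies.
\<close>

lemma points_support:
  assumes "connected_sgraph H" "x \<in> points H"
  shows "(\<exists>v\<in>verts H. x = vpt v) \<or> (\<exists>u v. {u, v} \<in> edges H \<and> {w. x w \<noteq> 0} = {u, v})"
proof -
  interpret connected_sgraph H by (rule assms(1))
  consider v where "v \<in> verts H" "x = vpt v"
    | u v t where "{u, v} \<in> edges H" "0 \<le> t" "t \<le> 1" "x = edge_pt u v t"
    using assms(2) unfolding points_def by blast
  then show ?thesis
  proof cases
    case 2
    note uv = edge_ends[OF 2(1)]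
    consider "t = 0" | "t = 1" | "0 < t" "t < 1" using 2(2,3) by linarith
    then show ?thesis
    proof cases
      case 3
      then have "{w. x w \<noteq> 0} = {u, v}" using uv(1) by (auto simp: 2(4) edge_pt_def vpt_def)
      then show ?thesis using 2(1) by blast
    qed (use 2 uv in auto)
  qed blast
qed

lemma support_vpt: "{w. vpt v w \<noteq> 0} = {v}"
  by (auto simp: vpt_def)

lemma vpt_inject: "vpt u = vpt v \<Longrightarrow> u = v"
  by (drule fun_cong[of _ _ u]) (simp add: vpt_def split: if_splits)

context connected_sgraph
begin

text \<open>
  A path and a cycle could also meet in an edge. If only the ends of the path lie on the cycle,
  such an edge joins these ends, which contradicts that the path is shorter than their distance
  in the cycle.
\<close>

lemma strict_shortcutI:
  assumes c: "cycle G c" and s: "walk_betw G p s q" "distinct s" and pq: "p \<in> set c" "q \<in> set c"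
    and interior: "set s \<inter> set c \<subseteq> {p, q}"
    and short: "len s < vdist (trace_graph c) p q"
  shows "strict_shortcut G c s"
proof -
  have wc: "walk G c" and ws: "walk G s" using c s(1) by (auto simp: cycle_def walk_betw_def)
  interpret C: connected_sgraph "trace_graph c" using connected_trace[OF wc] .
  interpret S: connected_sgraph "trace_graph s" using connected_trace[OF ws] .
  have ends: "hd s = p" "last s = q" "p \<in> set s" "q \<in> set s"
    using s(1) walk_betw_ends[OF s(1)] by (auto simp: walk_betw_def)
  have "x \<in> {vpt p, vpt q}" if x: "x \<in> points (trace_graph s)" "x \<in> points (trace_graph c)" for x
  proof -
    have not_both: False if e: "{u, v} \<in> edges (trace_graph s)" "{u, v} \<in> edges (trace_graph c)" for u v
    proof -
      have uv: "u \<noteq> v" "u \<in> set s" "v \<in> set s" "u \<in> set c" "v \<in> set c"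
        using S.edge_ends[OF e(1)] C.edge_ends[OF e(2)] by auto
      then have "{u, v} = {p, q}" using interior by blast
      then have "vdist (trace_graph c) p q \<le> 1" using C.vdist_edge e(2) by simp
      then have "len s = 0" using short by simp
      then have "p = q" using s(1) by (cases s) (auto simp: len_def walk_betw_def walk_def)
      then show False using uv(1) \<open>{u, v} = {p, q}\<close> by auto
    qed
    consider v where "v \<in> set s" "x = vpt v"
      | u v where "{u, v} \<in> edges (trace_graph s)" "{w. x w \<noteq> 0} = {u, v}"
      using points_support[OF S.connected_sgraph_axioms x(1)] unfolding verts_trace by blast
    note s_cases = this
    consider v where "v \<in> set c" "x = vpt v"
      | u v where "{u, v} \<in> edges (trace_graph c)" "{w. x w \<noteq> 0} = {u, v}"
      using points_support[OF C.connected_sgraph_axioms x(2)] unfolding verts_trace by blast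
    then show ?thesis
    proof cases
      case (1 v)
      note v = this
      from s_cases show ?thesis
      proof cases
        case (1 v')
        then have "vpt v' = vpt v" using v(2) by simp
        then have "v' = v" by (rule vpt_inject)
        then have "v \<in> set s" using 1(1) by simp
        then have "v \<in> {p, q}" using v(1) interior by blast
        then show ?thesis unfolding v(2) by blast
      next
        case (2 u' v')
        have "{u', v'} = {v}" using 2(2) unfolding v(2) support_vpt by (rule sym)
        then have "u' = v'" by blast
        then show ?thesis using S.edge_ends(1)[OF 2(1)] by blast
      qed
    next
      case (2 u v)
      note e = this
      from s_cases show ?thesis
      proof cases
        case (1 v')
        have "{u, v} = {v'}" using e(2) unfolding 1(2) support_vpt by (rule sym)
        then have "u = v" by blast
        then show ?thesis using C.edge_ends(1)[OF e(1)] by blast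
      next
        case (2 u' v')
        then have "{u', v'} = {u, v}" using e(2) by simp
        then show ?thesis using not_both[of u v] e(1) 2(1) by simp
      qed
    qed
  qed
  moreover have "{vpt p, vpt q} \<subseteq> points (trace_graph s) \<inter> points (trace_graph c)"
    using ends(3,4) pq by (simp add: vpt_points)
  ultimately have "points (trace_graph s) \<inter> points (trace_graph c) = {vpt p, vpt q}" by blast
  then show ?thesis
    using ends pq s short C.gdist_vpt[of p q] by (simp add: strict_shortcut_def shortcut_def simple_path_walk_betw)
qed

text \<open>
  The path is cut at its visits to the cycle. If no piece were shorter than the distance in the
  cycle between its ends, neither would be the whole path. The first piece that is shorter starts at
  a distance along the cycle from \<open>p\<close> of at most the length of the preceding pieces.
\<close>

lemma ex_strict_shortcut:
  assumes c: "cycle G c" and "walk_betw G p g q" "distinct g" "p \<in> set c" "q \<in> set c"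
    and "len g < vdist (trace_graph c) p q"
  shows "\<exists>s. strict_shortcut G c s \<and> len s \<le> len g \<and> vdist (trace_graph c) p (hd s) \<le> len g"
  using assms(2-)
proof (induction "length g" arbitrary: g p rule: less_induct)
  case less
  have wc: "walk G c" using c by (simp add: cycle_def)
  interpret C: connected_sgraph "trace_graph c" using connected_trace[OF wc] .
  have "p \<noteq> q" using less.prems(3,5) by auto
  then obtain g' where g: "g = p # g'" "q \<in> set g'"
    using less.prems(1) walk_betw_ends(2)[OF less.prems(1)] by (cases g) (auto simp: walk_betw_def)
  have "\<exists>t\<in>set g'. t \<in> set c" using g(2) less.prems(4) by blast
  then obtain ys t zs where g': "g' = ys @ t # zs" "t \<in> set c" "\<forall>y\<in>set ys. y \<notin> set c"
    using split_list_first_prop[of g' "\<lambda>t. t \<in> set c"] by blast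
  have gs: "g = (p # ys) @ t # zs" using g g' by simp
  let ?s = "p # ys @ [t]"
  have s: "walk_betw G p ?s t" and rest: "walk_betw G t (t # zs) q"
    using walk_betw_split[of G p "p # ys" t zs q] less.prems(1) unfolding gs by auto
  have lens: "len g = len ?s + len (t # zs)" unfolding gs by (simp add: len_def)
  have dist: "distinct ?s" "distinct (t # zs)" using less.prems(2) unfolding gs by auto
  show ?case
  proof (cases "len ?s < vdist (trace_graph c) p t")
    case True
    have "set ?s \<inter> set c \<subseteq> {p, t}" using g'(3) by auto
    then have "strict_shortcut G c ?s"
      using strict_shortcutI[OF c s dist(1) less.prems(3) g'(2) _ True] by blast
    then show ?thesis using lens less.prems(3) by (intro exI[of _ ?s]) simp
  next
    case False
    have t: "vdist (trace_graph c) p q \<le> vdist (trace_graph c) p t + vdist (trace_graph c) t q"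
      using C.vdist_triangle[of p t q] less.prems(3,4) g'(2) by simp
    have "len (t # zs) < vdist (trace_graph c) t q" using t False less.prems(5) lens by linarith
    then obtain s' where s': "strict_shortcut G c s'" "len s' \<le> len (t # zs)"
      "vdist (trace_graph c) t (hd s') \<le> len (t # zs)"
      using less.hyps[OF _ rest dist(2) g'(2) less.prems(4)] gs by auto
    have "hd s' \<in> set c" using s'(1) by (simp add: strict_shortcut_def shortcut_def)
    then have "vdist (trace_graph c) p (hd s') \<le> vdist (trace_graph c) p t + vdist (trace_graph c) t (hd s')"
      using C.vdist_triangle[of p t "hd s'"] less.prems(3) g'(2) by simp
    then show ?thesis using s' False lens by (intro exI[of _ s']) linarith
  qed
qed

end

section \<open>Distances along a cycle\<close>

lemma cycle_nth_inj_less: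
  assumes c: "cycle G c" and "c ! i = c ! j" "i < len c" "j < len c"
  shows "i = j"
proof -
  have "c ! (if i = 0 then len c else i) = c ! (if j = 0 then len c else j)"
    using assms(2) cycle_closed[OF c] by (cases "i = 0"; cases "j = 0") simp_all
  from cycle_nth_inj[OF c this] have "(if i = 0 then len c else i) = (if j = 0 then len c else j)"
    using assms(3,4) by simp
  then show ?thesis using assms(3,4) by (simp split: if_splits)
qed

lemma cycle_index:
  assumes c: "cycle G c" and "x \<in> set c"
  shows "\<exists>i<len c. x = c ! i"
proof -
  have L: "0 < len c" "length c = Suc (len c)" using c by (auto simp: cycle_def len_def)
  obtain i where "i < length c" and x: "x = c ! i"
    using assms(2) by (metis in_set_conv_nth)
  then have i: "i \<le> len c" using L(2) by simp
  show ?thesis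
  proof (cases "i = len c")
    case True
    then show ?thesis using x L(1) cycle_closed[OF c] by (intro exI[of _ 0]) simp
  next
    case False
    then show ?thesis using i x by (intro exI[of _ i]) simp
  qed
qed

text \<open>
  Distances along the cycle are bounded below by functions of the index that change by at most 1
  per step and agree at both ends of the index range, which are the same vertex.
\<close>

lemma cycle_potential:
  fixes \<phi> :: "nat \<Rightarrow> nat"
  assumes c: "cycle G c" and closed: "\<phi> (len c) = \<phi> 0"
    and step: "\<And>i. i < len c \<Longrightarrow> \<phi> (Suc i) \<le> \<phi> i + 1 \<and> \<phi> i \<le> \<phi> (Suc i) + 1"
    and C: "connected_sgraph (trace_graph c)"
    and ij: "i \<le> len c" "j \<le> len c"
  shows "\<phi> j \<le> \<phi> i + vdist (trace_graph c) (c ! i) (c ! j)"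
proof -
  interpret C: connected_sgraph "trace_graph c" by (rule C)
  have lenc: "length c = Suc (len c)" "0 < len c" using c by (auto simp: cycle_def len_def)
  define h where "h w = \<phi> (SOME i. 0 < i \<and> i \<le> len c \<and> c ! i = w)" for w
  have h_pos: "h (c ! i) = \<phi> i" if "0 < i" "i \<le> len c" for i
  proof -
    have "(SOME k. 0 < k \<and> k \<le> len c \<and> c ! k = c ! i) = i"
      by (rule some_equality) (use that cycle_nth_inj[OF c] in auto)
    then show ?thesis by (simp add: h_def)
  qed
  have h: "h (c ! i) = \<phi> i" if "i \<le> len c" for i
    using h_pos[of i] h_pos[of "len c"] that cycle_closed[OF c] closed lenc(2) by (cases "i = 0") auto
  have edge: "h v \<le> h u + 1" if "{u, v} \<in> edges (trace_graph c)" for u v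
  proof -
    obtain i where i: "{u, v} = {c ! i, c ! Suc i}" "i < len c"
      using \<open>{u, v} \<in> _\<close> lenc unfolding edges_trace by auto
    then have "h (c ! i) = \<phi> i" "h (c ! Suc i) = \<phi> (Suc i)" using h by auto
    then show ?thesis using i step[OF i(2)] by (auto simp: doubleton_eq_iff)
  qed
  have "h v \<le> h u + len q" if "walk_betw (trace_graph c) u q v" for u q v
    using that
  proof (induction rule: walk_betw_induct)
    case (step u w p v)
    then show ?case using edge[OF step(1)] by (simp add: len_Cons walk_betw_nonempty)
  qed simp
  moreover obtain q where "walk_betw (trace_graph c) (c ! i) q (c ! j)"
    "len q = vdist (trace_graph c) (c ! i) (c ! j)"
    using C.ex_geodesic[of "c ! i" "c ! j"] ij lenc by auto
  ultimately show ?thesis using h ij by metis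
qed

lemma rotate_cycle:
  assumes c: "cycle G c" and i: "i \<le> len c" and x: "x \<in> set c"
  obtains c' where "cycle G c'" "len c' = len c" "trace_graph c' = trace_graph c" "c' ! i = x"
proof -
  let ?L = "len c"
  have L: "3 \<le> ?L" "length c = Suc ?L" and w: "walk G c" using c by (auto simp: cycle_def len_def)
  obtain l where l: "l < ?L" "x = c ! l" using cycle_index[OF c x] by blast
  define r where "r = l + (?L - i)"
  define \<sigma> where "\<sigma> k = (k + r) mod ?L" for k
  define c' where "c' = map (\<lambda>k. c ! \<sigma> k) [0..<Suc ?L]"
  have nth: "c' ! k = c ! \<sigma> k" if "k \<le> ?L" for k using that by (simp add: c'_def del: upt_Suc)
  have len': "length c' = Suc ?L" by (simp add: c'_def)
  have \<sigma>_less: "\<sigma> k < ?L" for k using L(1) unfolding \<sigma>_def by (intro mod_less_divisor) simp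
  have \<sigma>_Suc: "c ! \<sigma> (Suc k) = c ! Suc (\<sigma> k)" for k
    using cycle_closed[OF c] L(1) by (auto simp: \<sigma>_def mod_Suc)
  have onto: "\<exists>k<?L. \<sigma> k = m" if "m < ?L" for m
  proof -
    have "\<sigma> ((m + (?L - r mod ?L)) mod ?L) = (m + (?L - r mod ?L) + r mod ?L) mod ?L"
      unfolding \<sigma>_def by (simp add: mod_simps)
    also have "m + (?L - r mod ?L) + r mod ?L = m + ?L"
      using L(1) mod_less_divisor[of ?L r] by linarith
    also have "(m + ?L) mod ?L = m" using that by simp
    finally show ?thesis using L(1) by (intro exI[of _ "(m + (?L - r mod ?L)) mod ?L"]) simp
  qed
  have set_eq: "set c' = set c"
  proof
    show "set c' \<subseteq> set c" using \<sigma>_less L(2) by (auto simp: c'_def less_SucI simp del: upt_Suc)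
    show "set c \<subseteq> set c'"
    proof
      fix y assume "y \<in> set c"
      then obtain m where m: "m < ?L" "y = c ! m" using cycle_index[OF c] by blast
      then obtain k where "k < ?L" "\<sigma> k = m" using onto by blast
      then have "y = c' ! k" "k < length c'" using nth m(2) len' by auto
      then show "y \<in> set c'" by simp
    qed
  qed
  have E: "edges (trace_graph c') = edges (trace_graph c)"
  proof
    show "edges (trace_graph c') \<subseteq> edges (trace_graph c)"
    proof
      fix e assume "e \<in> edges (trace_graph c')"
      then obtain k where "k < ?L" "e = {c' ! k, c' ! Suc k}" unfolding edges_trace len' by auto
      then have "e = {c ! \<sigma> k, c ! Suc (\<sigma> k)}" "Suc (\<sigma> k) < length c"
        using nth \<sigma>_Suc \<sigma>_less L(2) by auto
      then show "e \<in> edges (trace_graph c)" unfolding edges_trace by blast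
    qed
    show "edges (trace_graph c) \<subseteq> edges (trace_graph c')"
    proof
      fix e assume "e \<in> edges (trace_graph c)"
      then obtain m where m: "m < ?L" "e = {c ! m, c ! Suc m}" unfolding edges_trace L(2) by auto
      then obtain k where k: "k < ?L" "\<sigma> k = m" using onto by blast
      then have "e = {c' ! k, c' ! Suc k}" "Suc k < length c'" using m nth \<sigma>_Suc[of k] len' by auto
      then show "e \<in> edges (trace_graph c')" unfolding edges_trace by blast
    qed
  qed
  have tr: "trace_graph c' = trace_graph c"
    using E set_eq unfolding trace_graph_def edges_def by simp
  have "successively (\<lambda>u v. {u, v} \<in> edges (trace_graph c')) c'"
    unfolding successively_conv_nth edges_trace by blast
  then have "successively (\<lambda>u v. {u, v} \<in> edges G) c'"
    by (rule successively_mono) (use E edges_trace_subset[OF w] in blast)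
  then have "walk G c'"
    using set_eq w len' by (auto simp: walk_def)
  moreover have "hd c' = last c'"
  proof -
    have "hd c' = c' ! 0" "last c' = c' ! ?L"
      using len' by (auto simp: hd_conv_nth last_conv_nth simp flip: length_greater_0_conv)
    then show ?thesis using nth[of 0] nth[of ?L] by (simp add: \<sigma>_def)
  qed
  moreover have "distinct (tl c')"
  proof -
    have "inj_on (\<lambda>k. c ! \<sigma> k) {1..<Suc ?L}"
    proof (rule linorder_inj_onI)
      fix a b assume ab: "a < b" "a \<in> {1..<Suc ?L}" "b \<in> {1..<Suc ?L}"
      show "c ! \<sigma> a \<noteq> c ! \<sigma> b"
      proof
        assume "c ! \<sigma> a = c ! \<sigma> b"
        then have "(b + r) mod ?L = (a + r) mod ?L"
          using cycle_nth_inj_less[OF c _ \<sigma>_less \<sigma>_less] unfolding \<sigma>_def by metis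
        then have "?L dvd (b + r) - (a + r)" using ab(1) mod_eq_dvd_iff_nat[of "a + r" "b + r" ?L] by simp
        then show False using ab by (auto dest: dvd_imp_le)
      qed
    qed auto
    moreover have "tl c' = map (\<lambda>k. c ! \<sigma> k) [1..<Suc ?L]"
      by (simp add: c'_def upt_conv_Cons map_tl[symmetric] del: upt_Suc)
    ultimately show ?thesis by (simp add: distinct_map del: upt_Suc)
  qed
  ultimately have "cycle G c'" using len' L(1) by (simp add: cycle_def)
  moreover have "c' ! i = x"
  proof -
    have "\<sigma> i = l" using i l(1) by (simp add: \<sigma>_def r_def)
    then show ?thesis using nth[OF i] l(2) by simp
  qed
  ultimately show ?thesis using that[of c'] len' tr by (simp add: len_def)
qed


section \<open>Strict shortcuts near every vertex of a long cycle\<close>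

context connected_sgraph
begin

text \<open>
  The cycle is rotated so that \<open>x\<close> has index \<open>h\<close> and is the middle of the arc from index \<open>0\<close>
  to index \<open>2 * h\<close>. As the cycle has length at least \<open>4 * h\<close>, the arc is a shortest way along
  the cycle, and the rest of the cycle is at distance at least \<open>h\<close> from \<open>x\<close>.
\<close>

lemma strict_shortcut_near_vertex:
  assumes bottleneck: "\<And>a b x p. \<lbrakk>a \<in> verts G; b \<in> verts G; x \<in> verts G;
      vdist G a x + vdist G x b = vdist G a b; walk_betw G a p b\<rbrakk> \<Longrightarrow> \<exists>r\<in>set p. vdist G x r < h"
    and c: "cycle G c" and long: "4 * h \<le> len c" and x: "x \<in> set c"
  shows "\<exists>s. strict_shortcut G c s \<and> len s \<le> 2 * h \<and> vdist (trace_graph c) x (hd s) \<le> 3 * h"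
proof -
  have "h \<le> len c" using long by simp
  then obtain c' where c': "cycle G c'" "len c' = len c" "trace_graph c' = trace_graph c" "c' ! h = x"
    using rotate_cycle[OF c _ x] by blast
  let ?L = "len c'"
  have w: "walk G c'" and len': "length c' = Suc ?L" using c'(1) by (auto simp: cycle_def len_def)
  have L: "4 * h \<le> ?L" using long c'(2) by simp
  interpret C: connected_sgraph "trace_graph c'" using connected_trace[OF w] .
  define a where "a = c' ! 0"
  define b where "b = c' ! (2 * h)"
  have mem: "c' ! i \<in> set c'" "c' ! i \<in> verts G" if "i \<le> ?L" for i
    using that len' w by (auto simp: walk_def subset_iff)
  have in_c: "a \<in> set c'" "b \<in> set c'" "x \<in> set c'" and in_G: "a \<in> verts G" "b \<in> verts G" "x \<in> verts G"
    using mem[of 0] mem[of "2 * h"] mem[of h] L c'(4) by (auto simp: a_def b_def)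
  \<comment> \<open>The potential is the distance along the cycle from index 0.\<close>
  have "min (2 * h) (?L - 2 * h) \<le> min 0 (?L - 0) + vdist (trace_graph c') a b"
    unfolding a_def b_def
    by (rule cycle_potential[OF c'(1), of "\<lambda>i. min i (?L - i)" 0 "2 * h"])
      (use C.connected_sgraph_axioms L in \<open>auto simp: min_def\<close>)
  then have ab: "2 * h \<le> vdist (trace_graph c') a b" using L by simp
  have x_far: "h \<le> vdist (trace_graph c') x (c' ! i)" if i: "2 * h \<le> i" "i \<le> ?L" for i
  proof -
    \<comment> \<open>The potential is the distance from index \<open>h\<close>, cut off at \<open>h\<close> so that it agrees at both ends.\<close>
    have "min h (max (i - h) (h - i)) \<le> min h (max (h - h) (h - h)) + vdist (trace_graph c') (c' ! h) (c' ! i)"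
      by (rule cycle_potential[OF c'(1), of "\<lambda>i. min h (max (i - h) (h - i))" h i])
        (use C.connected_sgraph_axioms L i in \<open>auto simp: min_def max_def\<close>)
    then show ?thesis using i c'(4) by simp
  qed
  have "\<exists>s. strict_shortcut G c' s \<and> len s \<le> 2 * h \<and> vdist (trace_graph c') x (hd s) \<le> 3 * h"
  proof (cases "vdist G a b < 2 * h")
    case True
    obtain g where g: "walk_betw G a g b" "distinct g" "len g = vdist G a b"
      by (rule ex_simple_geodesic[OF in_G(1,2)])
    obtain s where s: "strict_shortcut G c' s" "len s \<le> len g" "vdist (trace_graph c') a (hd s) \<le> len g"
      using ex_strict_shortcut[OF c'(1) g(1,2) in_c(1,2)] g(3) True ab by auto
    have "hd s \<in> set c'" using s(1) by (simp add: strict_shortcut_def shortcut_def)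
    moreover have "vdist (trace_graph c') x a \<le> h"
      using C.vdist_walk[OF walk_trace[OF w], of 0 h] L len' c'(4) C.vdist_commute[of x a] in_c
      by (simp add: a_def)
    ultimately have "vdist (trace_graph c') x (hd s) \<le> 3 * h"
      using C.vdist_triangle[of x a "hd s"] in_c s(3) g(3) True by simp
    then show ?thesis using s(1,2) g(3) True by (intro exI[of _ s]) simp
  next
    case False
    have "vdist G a x \<le> h" "vdist G x b \<le> h"
      using vdist_walk[OF w, of 0 h] vdist_walk[OF w, of h "2 * h"] L len' c'(4)
      by (auto simp: a_def b_def)
    then have between: "vdist G a x + vdist G x b = vdist G a b"
      using vdist_triangle[OF in_G(1,3,2)] False by linarith
    let ?p = "take (Suc (?L - 2 * h)) (drop (2 * h) c')"
    have "walk_betw G b ?p (c' ! ?L)"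
      unfolding b_def using L len' by (intro walk_betw_segment[OF w]) auto
    then have "walk_betw G a (rev ?p) b"
      using walk_betw_rev cycle_closed[OF c'(1)] unfolding a_def by metis
    from bottleneck[OF in_G between this]
    obtain r where r: "r \<in> set ?p" "vdist G x r < h" by auto
    obtain i where i: "2 * h \<le> i" "i \<le> ?L" "r = c' ! i"
    proof -
      obtain k where "k < length ?p" "r = ?p ! k" using r(1) by (metis in_set_conv_nth)
      then show ?thesis using that[of "2 * h + k"] len' by simp
    qed
    obtain g where g: "walk_betw G x g r" "distinct g" "len g = vdist G x r"
      using ex_simple_geodesic[OF in_G(3) mem(2)[OF i(2)]] i(3) by metis
    have "len g < vdist (trace_graph c') x r" using g(3) r(2) x_far[OF i(1,2)] i(3) by simp
    from ex_strict_shortcut[OF c'(1) g(1,2) in_c(3) _ this]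
    obtain s where "strict_shortcut G c' s" "len s \<le> len g" "vdist (trace_graph c') x (hd s) \<le> len g"
      using mem(1)[OF i(2)] i(3) by blast
    then show ?thesis using g(3) r(2) by (intro exI[of _ s]) simp
  qed
  moreover have "set c' = set c" using c'(3) by (metis verts_trace)
  ultimately show ?thesis unfolding strict_shortcut_def shortcut_def c'(3) by simp
qed

text \<open>
  Beyond \<open>d\<close>, the density pays 1 for moving a point to a vertex and 1 for the strict inequality.
\<close>

lemma densely_chordalI:
  assumes near: "\<And>c x. \<lbrakk>cycle G c; k \<le> len c; x \<in> set c\<rbrakk> \<Longrightarrow>
    \<exists>s. strict_shortcut G c s \<and> len s \<le> m \<and> vdist (trace_graph c) x (hd s) \<le> d"
  shows "densely_chordal G (real d + 2) k m"
  unfolding densely_chordal_def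
proof (intro allI impI)
  fix c assume c: "cycle G c \<and> k \<le> len c"
  then have w: "walk G c" by (simp add: cycle_def)
  interpret C: connected_sgraph "trace_graph c" using connected_trace[OF w] .
  have "\<forall>x\<in>set c. \<exists>s. strict_shortcut G c s \<and> len s \<le> m \<and> vdist (trace_graph c) x (hd s) \<le> d"
    using near c by blast
  then obtain \<sigma> where \<sigma>: "\<forall>x\<in>set c. strict_shortcut G c (\<sigma> x) \<and> len (\<sigma> x) \<le> m \<and>
      vdist (trace_graph c) x (hd (\<sigma> x)) \<le> d"
    by metis
  then have ends: "hd (\<sigma> x) \<in> set c" "last (\<sigma> x) \<in> set c" if "x \<in> set c" for x
    using that by (auto simp: strict_shortcut_def shortcut_def)
  let ?A = "\<Union>s\<in>\<sigma> ` set c. {vpt (hd s), vpt (last s)}"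
  have "eps_dense (real d + 2) ?A (points (trace_graph c)) (gdist (trace_graph c))"
    unfolding eps_dense_def
  proof (intro conjI ballI)
    show "?A \<subseteq> points (trace_graph c)" using ends by (auto simp: vpt_points)
    fix y assume y: "y \<in> points (trace_graph c)"
    obtain v where v: "v \<in> verts (trace_graph c)" "gdist (trace_graph c) y (vpt v) \<le> 1"
      by (rule C.gdist_near_vertex[OF y])
    have v': "v \<in> set c" using v(1) by simp
    let ?z = "hd (\<sigma> v)"
    have z: "?z \<in> verts (trace_graph c)" using ends(1)[OF v'] by simp
    have "gdist (trace_graph c) (vpt v) (vpt ?z) \<le> real d" using C.gdist_vpt[OF v(1) z] \<sigma> v' by simp
    then have "gdist (trace_graph c) y (vpt ?z) < real d + 2"
      using C.gdist_triangle[OF y vpt_points[OF v(1)] vpt_points[OF z]] v(2) by linarith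
    then have "gdist (trace_graph c) (vpt ?z) y < real d + 2" by (simp add: gdist_commute)
    then show "\<exists>a\<in>?A. gdist (trace_graph c) a y < real d + 2" using v' by blast
  qed
  then show "\<exists>S. finite S \<and> (\<forall>s\<in>S. strict_shortcut G c s \<and> len s \<le> m) \<and>
      eps_dense (real d + 2) (\<Union>s\<in>S. {vpt (hd s), vpt (last s)}) (points (trace_graph c)) (gdist (trace_graph c))"
    using \<sigma> by (intro exI[of _ "\<sigma> ` set c"]) simp
qed

end

theorem quasi_isometric_tree_imp_chordal:
  assumes "connected_graph G" "tree T" "quasi_isometric_graphs G T"
  shows "\<exists>\<epsilon> > 0. \<exists>k m. k \<ge> 4 \<and> k \<ge> 2 * m \<and> densely_chordal G \<epsilon> k m"
proof -
  interpret connected_sgraph G using assms(1) by unfold_locales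
  have T: "connected_graph T" using assms(2) by (simp add: tree_def)
  obtain F K where F: "\<And>v. v \<in> verts G \<Longrightarrow> F v \<in> verts T"
    "\<And>u v. u \<in> verts G \<Longrightarrow> v \<in> verts G \<Longrightarrow> vdist T (F u) (F v) \<le> K * vdist G u v + K"
    "\<And>u v. u \<in> verts G \<Longrightarrow> v \<in> verts G \<Longrightarrow> vdist G u v \<le> K * vdist T (F u) (F v) + K"
    using quasi_isometric_vertex_map[OF T assms(3)] by blast
  define h where "h = 2 * (K * (4 * K) + K) + 1"
  have bn: "\<exists>r\<in>set p. vdist G x r < h"
    if "a \<in> verts G" "b \<in> verts G" "x \<in> verts G" "vdist G a x + vdist G x b = vdist G a b"
      "walk_betw G a p b" for a b x p
    using bottleneck[OF assms(2) F that] unfolding h_def by (metis less_add_one order_le_less_trans)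
  have "densely_chordal G (real (3 * h) + 2) (4 * h + 4) (2 * h)"
    by (rule densely_chordalI, rule strict_shortcut_near_vertex[OF bn]) auto
  then show ?thesis by (intro exI[of _ "real (3 * h) + 2"] exI[of _ "4 * h + 4"] exI[of _ "2 * h"] conjI) auto
qed

theorem corollary3p7:
  fixes G :: "'a sgraph"
  assumes "connected_graph G"
  shows "((\<exists>T :: 'a sgraph. tree T \<and> quasi_isometric_graphs G T) \<longleftrightarrow>
           (\<exists>\<epsilon> > 0. \<exists>k m. k \<ge> 4 \<and> k \<ge> 2 * m \<and> densely_chordal G \<epsilon> k m)) \<and>
         ((\<exists>T :: 'b sgraph. tree T \<and> quasi_isometric_graphs G T) \<longrightarrow>
           (\<exists>\<epsilon> > 0. \<exists>k m. k \<ge> 4 \<and> k \<ge> 2 * m \<and> densely_chordal G \<epsilon> k m))"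
proof (intro conjI iffI impI)
  show "\<exists>T :: 'a sgraph. tree T \<and> quasi_isometric_graphs G T"
    if "\<exists>\<epsilon> > 0. \<exists>k m. k \<ge> 4 \<and> k \<ge> 2 * m \<and> densely_chordal G \<epsilon> k m"
    using chordal_imp_quasi_isometric_tree[OF assms] that by blast
  show "\<exists>\<epsilon> > 0. \<exists>k m. k \<ge> 4 \<and> k \<ge> 2 * m \<and> densely_chordal G \<epsilon> k m"
    if "\<exists>T :: 'a sgraph. tree T \<and> quasi_isometric_graphs G T"
    using quasi_isometric_tree_imp_chordal[OF assms] that by blast
  show "\<exists>\<epsilon> > 0. \<exists>k m. k \<ge> 4 \<and> k \<ge> 2 * m \<and> densely_chordal G \<epsilon> k m"
    if "\<exists>T :: 'b sgraph. tree T \<and> quasi_isometric_graphs G T"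
    using quasi_isometric_tree_imp_chordal[OF assms] that by blast
qed

end
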